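(* Let $\{g_{ij}^*\}_{(i,j)\in\mathcal{E}}$ be feasible bearing constraints in $\mathbb{R}^3$ that ensure infinitesimal bearing rigidity. Fix initial orientations $Q_i(0)\in SO(3)$, $i\in\mathcal{V}$, for which there exists $Q_0\in SO(3)$ such that $Q_0^{\mathrm T}Q_i(0)$ is (non-symmetric) positive definite for all $i\in\mathcal{V}$, and consider $$\dot p_i=-\sum_{j\in\mathcal{N}_i}P_{g_{ij}}(Q_i+Q_j)g_{ij}^*,\qquad \dot Q_i=-\sum_{j\in\mathcal{N}_i}Q_i\left(Q_j^{\mathrm T}Q_i-Q_i^{\mathrm T}Q_j\right),\qquad i\in\mathcal{V}.$$ Fix a centroid $c\in\mathbb{R}^3$ and a scale $s>0$, let $p^*$ be the associated target configuration, $r^*=p^*-\mathbf 1\otimes c$, and let $$\mathcal{S}_0=\{\delta\in\mathbb{R}^{3n}:\ \|\delta+r^*\|=\|r^*\|,\ (\mathbf 1\otimes I_3)^{\mathrm T}\delta=0\}$$ be the sphere of all $\delta=p-p^*$ with $p$ of centroid $c$ and scale $s$. Then there is a subset $N\subset\mathcal{S}_0$ of measure zero such that for every $\delta(0)\in\mathcal{S}_0\setminus N$ for which the solution with $p(0)=p^*+\delta(0)$ exists for all $t\ge0$ without collisions of neighboring agents, $\delta(t)=p(t)-p^*$ converges to $0$ as $t\to\infty$.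
   Context: Let $n\ge2$ and let $\mathcal{G}=(\mathcal{V},\mathcal{E})$ be a fixed undirected graph without self-loops, $\mathcal{V}=\{1,\dots,n\}$, with $m$ edges, neighbor sets $\mathcal{N}_i$. Agent $i$ has position $p_i\in\mathbb{R}^3$ and orientation $Q_i\in SO(3)$; $p=[p_1^{\mathrm T},\dots,p_n^{\mathrm T}]^{\mathrm T}$. For $(i,j)\in\mathcal{E}$, $g_{ij}=(p_j-p_i)/\|p_j-p_i\|$ (defined when $p_i\ne p_j$). For nonzero $x\in\mathbb{R}^3$, $P_x=I_3-xx^{\mathrm T}/\|x\|^2$. $\mathbf 1=[1,\dots,1]^{\mathrm T}\in\mathbb{R}^n$. The displayed system is the closed loop of $\dot p_i=Q_iv_i^b$, $\dot Q_i=Q_i[w_i^b]_\times$ under the local-frame control law $v_i^b=-\sum_{j\in\mathcal{N}_i}P_{g_{ij}^b}(I_3+Q_i^{\mathrm T}Q_j)g_{ij}^*$, $[w_i^b]_\times=-\sum_{j\in\mathcal{N}_i}(Q_j^{\mathrm T}Q_i-Q_i^{\mathrm T}Q_j)$ with $g_{ij}^b=Q_i^{\mathrm T}g_{ij}$, where $[\cdot]_\times$ is the usual $3\times3$ skew-symmetric matrix of a vector. Bearing constraints are constant unit vectors $g_{ij}^*\in\mathbb{R}^3$, $(i,j)\in\mathcal{E}$, with $g_{ij}^*=-g_{ji}^*$. They are feasible if some configuration satisfies $g_{ij}=g_{ij}^*$ for all $(i,j)\in\mathcal{E}$. They ensure infinitesimal bearing rigidity if any formation $\mathcal{G}(q)$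 satisfying them is infinitesimally bearing rigid, meaning: with $R(q)$ the Jacobian with respect to $q$ of the stacked bearing vector $[g_1^{\mathrm T},\dots,g_m^{\mathrm T}]^{\mathrm T}$ (one bearing per edge for an arbitrary orientation of the edges), every $\delta q$ with $R(q)\delta q=0$ has the form $\mathbf{1}\otimes x+\alpha q$, $x\in\mathbb{R}^3$, $\alpha\in\mathbb{R}$. (This forces $\mathcal{G}$ to be connected.) A matrix $M$ is (non-symmetric) positive definite if $x^{\mathrm T}Mx>0$ for all $x\ne0$. Under the stated hypothesis on $Q_i(0)$ and connectedness, it is a known result that the orientations, whose dynamics do not depend on the positions, all converge to a common $Q^*\in SO(3)$ as $t\to\infty$; $Q^*$ denotes this limit. The centroid and scale of $p$ are $\bar p=\frac1n\sum_i p_i$ and $\sqrt{\frac1n\sum_i\|p_i-\bar p\|^2}$; both are invariant under the dynamics. The target configuration $p^*$ is the unique configuration with centroid $c$, scale $s$ and $(p_j^*-p_i^* )/\|p_j^*-p_i^*\|=Q^*g_{ij}^*$ for all $(i,j)\in\mathcal{E}$. Measure zero refers to the surface measure of the sphere $\mathcal{S}_0$. *)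

theory Defs
  imports "HOL-Analysis.Analysis"
begin

text \<open>Undirected graphs on the vertex type are symmetric irreflexive edge relations.
  Configurations are stacked vectors of type \<open>real^3^'n\<close>; their norm is the
  Euclidean norm of the stacked vector in dimension \<open>3n\<close>.\<close>

definition neighbors :: "('n \<times> 'n) set \<Rightarrow> 'n \<Rightarrow> 'n set" where
  "neighbors E i = {j. (i, j) \<in> E}"

definition bearing :: "real^3^'n \<Rightarrow> 'n \<Rightarrow> 'n \<Rightarrow> real^3" where
  "bearing p i j = (p $ j - p $ i) /\<^sub>R norm (p $ j - p $ i)"

definition perp_proj :: "real^3 \<Rightarrow> real^3^3" where
  "perp_proj x = mat 1 - (\<chi> a b. x $ a * x $ b) /\<^sub>R (norm x)\<^sup>2"

definition positive_definite :: "real^3^3 \<Rightarrow> bool" where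
  "positive_definite M \<longleftrightarrow> (\<forall>x. x \<noteq> 0 \<longrightarrow> x \<bullet> (M *v x) > 0)"

definition stack_const :: "real^3 \<Rightarrow> real^3^'n" where
  "stack_const x = (\<chi> i. x)"

definition collision_free :: "('n::finite \<times> 'n) set \<Rightarrow> real^3^'n \<Rightarrow> bool" where
  "collision_free E p \<longleftrightarrow> (\<forall>(i, j)\<in>E. p $ i \<noteq> p $ j)"

definition bearing_constraints :: "('n::finite \<times> 'n) set \<Rightarrow> ('n \<Rightarrow> 'n \<Rightarrow> real^3) \<Rightarrow> bool" where
  "bearing_constraints E g \<longleftrightarrow> (\<forall>(i, j)\<in>E. norm (g i j) = 1 \<and> g i j = - g j i)"

definition satisfies_bearings ::
    "('n::finite \<times> 'n) set \<Rightarrow> ('n \<Rightarrow> 'n \<Rightarrow> real^3) \<Rightarrow> real^3^'n \<Rightarrow> bool" where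
  "satisfies_bearings E g p \<longleftrightarrow>
     collision_free E p \<and> (\<forall>(i, j)\<in>E. bearing p i j = g i j)"

definition feasible :: "('n::finite \<times> 'n) set \<Rightarrow> ('n \<Rightarrow> 'n \<Rightarrow> real^3) \<Rightarrow> bool" where
  "feasible E g \<longleftrightarrow> (\<exists>p. satisfies_bearings E g p)"

definition edge_orientation :: "('n::finite \<times> 'n) set \<Rightarrow> ('n \<times> 'n) set \<Rightarrow> bool" where
  "edge_orientation E A \<longleftrightarrow> A \<union> A\<inverse> = E \<and> A \<inter> A\<inverse> = {}"

text \<open>The stacked bearing vector has one block per oriented edge in \<open>A\<close>. To have a
  fixed index type, it is padded with constant zero blocks, which do not change the kernel
  of the derivative.\<close>

definition stacked_bearings :: "('n::finite \<times> 'n) set \<Rightarrow> real^3^'n \<Rightarrow> real^3^('n \<times> 'n)" where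
  "stacked_bearings A q = (\<chi> e. if e \<in> A then bearing q (fst e) (snd e) else 0)"

text \<open>Reversing an edge only changes the sign of a block, so the kernel is the same for
  every choice of the edge orientation \<open>A\<close>, and such an \<open>A\<close> always exists.\<close>

definition inf_bearing_rigid :: "('n::finite \<times> 'n) set \<Rightarrow> real^3^'n \<Rightarrow> bool" where
  "inf_bearing_rigid E q \<longleftrightarrow>
     (\<exists>A. edge_orientation E A \<and>
       (\<forall>dq. frechet_derivative (stacked_bearings A) (at q) dq = 0 \<longrightarrow>
          (\<exists>x \<alpha>. dq = stack_const x + \<alpha> *\<^sub>R q)))"

definition ensures_inf_bearing_rigidity ::
    "('n::finite \<times> 'n) set \<Rightarrow> ('n \<Rightarrow> 'n \<Rightarrow> real^3) \<Rightarrow> bool" where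
  "ensures_inf_bearing_rigidity E g \<longleftrightarrow>
     (\<forall>q. satisfies_bearings E g q \<longrightarrow> inf_bearing_rigid E q)"

definition orientation_field :: "('n::finite \<times> 'n) set \<Rightarrow> real^3^3^'n \<Rightarrow> real^3^3^'n" where
  "orientation_field E Q =
     (\<chi> i. - (\<Sum>j\<in>neighbors E i.
        Q $ i ** (transpose (Q $ j) ** Q $ i - transpose (Q $ i) ** Q $ j)))"

definition position_field ::
    "('n::finite \<times> 'n) set \<Rightarrow> ('n \<Rightarrow> 'n \<Rightarrow> real^3) \<Rightarrow> real^3^3^'n \<Rightarrow> real^3^'n \<Rightarrow> real^3^'n" where
  "position_field E g Q p =
     (\<chi> i. - (\<Sum>j\<in>neighbors E i.
        perp_proj (bearing p i j) *v ((Q $ i + Q $ j) *v g i j)))"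

definition orientation_solution ::
    "('n::finite \<times> 'n) set \<Rightarrow> (real \<Rightarrow> real^3^3^'n) \<Rightarrow> bool" where
  "orientation_solution E Q \<longleftrightarrow>
     (\<forall>t\<ge>0. (\<forall>i. rotation_matrix (Q t $ i)) \<and>
       (Q has_vector_derivative orientation_field E (Q t)) (at t within {0..}))"

definition position_solution ::
    "('n::finite \<times> 'n) set \<Rightarrow> ('n \<Rightarrow> 'n \<Rightarrow> real^3) \<Rightarrow> (real \<Rightarrow> real^3^3^'n)
      \<Rightarrow> (real \<Rightarrow> real^3^'n) \<Rightarrow> bool" where
  "position_solution E g Q p \<longleftrightarrow>
     (\<forall>t\<ge>0. collision_free E (p t) \<and>
       (p has_vector_derivative position_field E g (Q t) (p t)) (at t within {0..}))"

definition limit_orientation :: "(real \<Rightarrow> real^3^3^'n) \<Rightarrow> real^3^3" where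
  "limit_orientation Q = (THE R. \<forall>i. ((\<lambda>t. Q t $ i) \<longlongrightarrow> R) at_top)"

definition centroid :: "real^3^'n \<Rightarrow> real^3" where
  "centroid p = (\<Sum>i\<in>UNIV. p $ i) /\<^sub>R real CARD('n)"

definition config_scale :: "real^3^'n \<Rightarrow> real" where
  "config_scale p = sqrt ((\<Sum>i\<in>UNIV. (norm (p $ i - centroid p))\<^sup>2) / real CARD('n))"

definition target_configuration ::
    "('n::finite \<times> 'n) set \<Rightarrow> ('n \<Rightarrow> 'n \<Rightarrow> real^3) \<Rightarrow> real^3^3 \<Rightarrow> real^3 \<Rightarrow> real \<Rightarrow> real^3^'n" where
  "target_configuration E g R c s =
     (THE p. centroid p = c \<and> config_scale p = s \<and> satisfies_bearings E (\<lambda>i j. R *v g i j) p)"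

definition error_sphere :: "real^3^'n::finite \<Rightarrow> (real^3^'n) set" where
  "error_sphere r = {\<delta>. norm (\<delta> + r) = norm r \<and> (\<Sum>i\<in>UNIV. \<delta> $ i) = 0}"

text \<open>The \<open>k\<close>-dimensional Hausdorff outer measure for \<open>k > 0\<close>, without the customary constant
  factor. Up to that factor, it is the surface measure on \<open>k\<close>-dimensional spheres.
  Boundedness is required because \<open>diameter\<close> is meaningless on unbounded sets.\<close>

definition hausdorff_measure :: "nat \<Rightarrow> 'a::metric_space set \<Rightarrow> ennreal" where
  "hausdorff_measure k A =
     (SUP d\<in>{0::real<..}.
        INF U\<in>{U :: nat \<Rightarrow> 'a set.
                 A \<subseteq> (\<Union>m. U m) \<and> (\<forall>m. bounded (U m) \<and> diameter (U m) \<le> d)}.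
          \<Sum>m. ennreal (diameter (U m) ^ k))"

text \<open>For \<open>r \<noteq> 0\<close> with blocks summing to zero, \<open>error_sphere r\<close> is a sphere in a linear
  subspace of dimension \<open>3n - 3\<close>, hence has dimension \<open>3n - 4\<close>, which is positive for
  \<open>n \<ge> 2\<close>.\<close>

definition surface_null :: "(real^3^'n::finite) set \<Rightarrow> bool" where
  "surface_null N \<longleftrightarrow> hausdorff_measure (3 * CARD('n) - 4) N = 0"

end

theory Submission
  imports Defs
begin

text \<open>Orientations: with a reference rotation \<open>R\<close>, let \<open>w\<^sub>i > 0\<close> be the scalar part of the unit
  quaternion of \<open>R\<^sup>T Q\<^sub>i\<close> and \<open>c\<^sub>i\<^sub>j\<close> that of \<open>Q\<^sub>i\<^sup>T Q\<^sub>j\<close>. As long as all \<open>R\<^sup>T Q\<^sub>i\<close> are positive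
  definite, \<open>c\<^sub>i\<^sub>j > 0\<close> and \<open>w\<^sub>i' = 2 \<Sum>\<^sub>j c\<^sub>i\<^sub>j (w\<^sub>j - c\<^sub>i\<^sub>j w\<^sub>i)\<close>. Hence \<open>min\<^sub>i w\<^sub>i\<close> is nondecreasing, and the sum of
  the \<open>w\<^sub>i\<close> has derivative \<open>2 \<Sum>\<^sub>i\<^sub>j c\<^sub>i\<^sub>j (1 - c\<^sub>i\<^sub>j) w\<^sub>i\<close>; being bounded, it forces near consensus at
  arbitrarily late times. Using an accumulation point as the new reference \<open>R\<close>, monotonicity of
  \<open>min\<^sub>i w\<^sub>i\<close> turns it into the limit.

  Positions: centroid and scale are conserved, so with \<open>r = p - c\<close> and \<open>\<rho> = |r| = |r\<^sup>*|\<close> the function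
  \<open>y = r\<^sup>* \<bullet> r\<close> satisfies \<open>y' \<ge> k (\<rho>\<^sup>4 - y\<^sup>2) - \<epsilon>(t)\<close> with \<open>k > 0\<close> by rigidity and \<open>\<epsilon> \<longlongrightarrow> 0\<close> since the
  orientations converge. Therefore \<open>r\<close> tends to \<open>r\<^sup>*\<close> or to \<open>- r\<^sup>*\<close>. Near \<open>- r\<^sup>*\<close> the field is expanding
  along the sphere, so the distance of two solutions tending to \<open>- r\<^sup>*\<close> is eventually nondecreasing
  and hence zero: at most one initial value is exceptional.\<close>

section \<open>Rotations and unit quaternions\<close>

text \<open>The derivative of the trace contains the cubic term
  \<open>A ** transpose B ** A\<close>. For unit quaternions its contribution factors, and dividing
  by w_i leaves a consensus equation with positive weights. Positive definiteness puts the
  quaternions within angle pi/4 of the reference, hence less than pi/2 apart; this is where c_ij > 0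
  comes from. In one fixed frame min w_i may stall below 1, and near consensus is known only at
  isolated times. In the frame of an accumulation point, one such time brings min w_i close to 1,
  where it stays.

  The position field depends on time and is singular at collisions, with no lower bound on edge
  lengths valid for all times and solutions. Two solutions are therefore compared directly instead
  of linearising. Repulsion only controls differences of bearings; rigidity and the common sphere
  convert these into differences of positions. The distance is first seen to vanish at a late time
  and is carried back to time 0 by a Gronwall estimate on a compact interval, where edges stay
  bounded away from 0.\<close>

text \<open>The cosine of half the rotation angle, i.e. the scalar part of the unit quaternion. On matrices
  with trace below \<open>-1\<close> the square root is negative.\<close>

definition half_cos :: "real^3^3 \<Rightarrow> real" where
  "half_cos A = sqrt (1 + trace A) / 2"

text \<open>The Euler-Rodrigues matrix of the map v to q v conj(q) with q = w + xi + yj + zk. It is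
  kept homogeneous, without using |q| = 1, so that the formulas below are polynomial identities in
  the components.\<close>

definition quat_matrix :: "real \<Rightarrow> real \<Rightarrow> real \<Rightarrow> real \<Rightarrow> real^3^3" where
  "quat_matrix w x y z = vector
     [vector [w^2 + x^2 - y^2 - z^2, 2 * (x * y - w * z), 2 * (x * z + w * y)],
      vector [2 * (x * y + w * z), w^2 - x^2 + y^2 - z^2, 2 * (y * z - w * x)],
      vector [2 * (x * z - w * y), 2 * (y * z + w * x), w^2 - x^2 - y^2 + z^2]]"

lemma trace_3: "trace (A :: real^3^3) = A$1$1 + A$2$2 + A$3$3"
  by (simp add: trace_def sum_3)

text \<open>The adjugate and the transpose are both inverse to a matrix of determinant 1 in SO(3),
  so they agree. The entrywise form is what the method \<open>algebra\<close> consumes in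
  \<open>rotation_quaternion\<close>.\<close>

lemma rotation_matrix_cofactors:
  fixes A :: "real^3^3"
  assumes "rotation_matrix A"
  shows "A$1$1 = A$2$2 * A$3$3 - A$2$3 * A$3$2"
    "A$2$2 = A$1$1 * A$3$3 - A$1$3 * A$3$1"
    "A$3$3 = A$1$1 * A$2$2 - A$1$2 * A$2$1"
    "A$1$2 = A$2$3 * A$3$1 - A$2$1 * A$3$3"
    "A$2$1 = A$1$3 * A$3$2 - A$1$2 * A$3$3"
    "A$1$3 = A$2$1 * A$3$2 - A$2$2 * A$3$1"
    "A$3$1 = A$1$2 * A$2$3 - A$1$3 * A$2$2"
    "A$2$3 = A$1$2 * A$3$1 - A$1$1 * A$3$2"
    "A$3$2 = A$1$3 * A$2$1 - A$1$1 * A$2$3"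
proof -
  have o: "orthogonal_matrix A" and d: "det A = 1"
    using assms by (auto simp: rotation_matrix_def)
  let ?C = "vector [vector [A$2$2 * A$3$3 - A$2$3 * A$3$2, A$1$3 * A$3$2 - A$1$2 * A$3$3, A$1$2 * A$2$3 - A$1$3 * A$2$2],
     vector [A$2$3 * A$3$1 - A$2$1 * A$3$3, A$1$1 * A$3$3 - A$1$3 * A$3$1, A$1$3 * A$2$1 - A$1$1 * A$2$3],
     vector [A$2$1 * A$3$2 - A$2$2 * A$3$1, A$1$2 * A$3$1 - A$1$1 * A$3$2, A$1$1 * A$2$2 - A$1$2 * A$2$1]] :: real^3^3"
  have "?C ** A = mat 1"
    using d by (simp add: vec_eq_iff forall_3 matrix_matrix_mult_def sum_3 mat_def det_3 algebra_simps)
  moreover have "A ** transpose A = mat 1" using o by (simp add: orthogonal_matrix_def)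
  ultimately have C: "?C = transpose A"
    using matrix_mul_assoc[of ?C A "transpose A"] by (simp only: matrix_mul_lid matrix_mul_rid)
  show "A$1$1 = A$2$2 * A$3$3 - A$2$3 * A$3$2"
    "A$2$2 = A$1$1 * A$3$3 - A$1$3 * A$3$1"
    "A$3$3 = A$1$1 * A$2$2 - A$1$2 * A$2$1"
    "A$1$2 = A$2$3 * A$3$1 - A$2$1 * A$3$3"
    "A$2$1 = A$1$3 * A$3$2 - A$1$2 * A$3$3"
    "A$1$3 = A$2$1 * A$3$2 - A$2$2 * A$3$1"
    "A$3$1 = A$1$2 * A$2$3 - A$1$3 * A$2$2"
    "A$2$3 = A$1$2 * A$3$1 - A$1$1 * A$3$2"
    "A$3$2 = A$1$3 * A$2$1 - A$1$1 * A$2$3"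
    using arg_cong[OF C, of "\<lambda>M. M$1$1"] arg_cong[OF C, of "\<lambda>M. M$2$2"] arg_cong[OF C, of "\<lambda>M. M$3$3"] arg_cong[OF C, of "\<lambda>M. M$2$1"] arg_cong[OF C, of "\<lambda>M. M$1$2"] arg_cong[OF C, of "\<lambda>M. M$3$1"] arg_cong[OF C, of "\<lambda>M. M$1$3"] arg_cong[OF C, of "\<lambda>M. M$3$2"] arg_cong[OF C, of "\<lambda>M. M$2$3"]
    by (simp_all only: transpose_def vec_lambda_beta vector_3)
qed

lemma orthogonal_matrix_entries:
  fixes A :: "real^3^3"
  assumes "orthogonal_matrix A"
  shows "(\<Sum>k\<in>UNIV. A$i$k * A$j$k) = (if i = j then 1 else 0)"
    "(\<Sum>k\<in>UNIV. A$k$i * A$k$j) = (if i = j then 1 else 0)"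
proof -
  have 1: "A ** transpose A = mat 1" "transpose A ** A = mat 1"
    using assms by (auto simp: orthogonal_matrix_def)
  from arg_cong[OF 1(1), of "\<lambda>M. M$i$j"] arg_cong[OF 1(2), of "\<lambda>M. M$i$j"]
  show "(\<Sum>k\<in>UNIV. A$i$k * A$j$k) = (if i = j then 1 else 0)"
    "(\<Sum>k\<in>UNIV. A$k$i * A$k$j) = (if i = j then 1 else 0)"
    by (auto simp: matrix_matrix_mult_def transpose_def mat_def)
qed

text \<open>A trace above -1 excludes half turns, so the scalar part w is nonzero and the vector
  part can be read off the antisymmetric part of A, divided by 4w.\<close>

lemma rotation_quaternion:
  fixes A :: "real^3^3"
  assumes A: "rotation_matrix A" and tr: "trace A > -1"
  obtains x y z where "(half_cos A)^2 + x^2 + y^2 + z^2 = 1"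
    "A = quat_matrix (half_cos A) x y z"
proof -
  define w where "w = half_cos A"
  have w: "w > 0" "4 * w^2 = 1 + trace A"
    using tr by (auto simp: w_def half_cos_def power_divide)
  define x y z where "x = (A$3$2 - A$2$3) / (4*w)" and "y = (A$1$3 - A$3$1) / (4*w)"
    and "z = (A$2$1 - A$1$2) / (4*w)"
  have e: "4*w*x = A$3$2 - A$2$3" "4*w*y = A$1$3 - A$3$1" "4*w*z = A$2$1 - A$1$2"
    using w by (auto simp: x_def y_def z_def)
  have o: "orthogonal_matrix A" using A by (auto simp: rotation_matrix_def)
  note C = rotation_matrix_cofactors[OF A]
  have R1: "A$i$1 * A$j$1 + A$i$2 * A$j$2 + A$i$3 * A$j$3 = (if i = j then 1 else 0)"
    and R2: "A$1$i * A$1$j + A$2$i * A$2$j + A$3$i * A$3$j = (if i = j then 1 else 0)" for i j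
    using orthogonal_matrix_entries[OF o, of i j] by (simp_all add: sum_3)
  note w4 = w(2)[unfolded trace_3]
  \<comment> \<open>Multiplied by 4w^2, a claim about a product of two of x, y, z becomes a
    polynomial identity in the entries of A. It follows from orthogonality and the cofactor
    equations, and the factor cancels because w > 0.\<close>
  have sq: "4 * w^2 * (4 * x^2) = (4*w*x)^2" "4 * w^2 * (4 * y^2) = (4*w*y)^2" "4 * w^2 * (4 * z^2) = (4*w*z)^2"
     "4 * w^2 * (4 * (x*y)) = (4*w*x)*(4*w*y)" "4 * w^2 * (4 * (x*z)) = (4*w*x)*(4*w*z)" "4 * w^2 * (4 * (y*z)) = (4*w*y)*(4*w*z)"
    by (auto simp: power2_eq_square)
  have xx: "4*x^2 = 1 + A$1$1 - A$2$2 - A$3$3"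
  proof -
    have "4 * w^2 * (4 * x^2) = 4 * w^2 * (1 + A$1$1 - A$2$2 - A$3$3)"
      unfolding sq unfolding e w4 using C(1) R1[of 2 2, simplified] R1[of 3 3, simplified] R2[of 1 1, simplified] by algebra
    then show ?thesis using w tr by auto
  qed
  have yy: "4*y^2 = 1 - A$1$1 + A$2$2 - A$3$3"
  proof -
    have "4 * w^2 * (4 * y^2) = 4 * w^2 * (1 - A$1$1 + A$2$2 - A$3$3)"
      unfolding sq unfolding e w4 using C(2) R1[of 1 1, simplified] R1[of 3 3, simplified] R2[of 2 2, simplified] by algebra
    then show ?thesis using w tr by auto
  qed
  have zz: "4*z^2 = 1 - A$1$1 - A$2$2 + A$3$3"
  proof -
    have "4 * w^2 * (4 * z^2) = 4 * w^2 * (1 - A$1$1 - A$2$2 + A$3$3)"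
      unfolding sq unfolding e w4 using C(3) R1[of 1 1, simplified] R1[of 2 2, simplified] R2[of 3 3, simplified] by algebra
    then show ?thesis using w tr by auto
  qed
  have xy: "4*(x*y) = A$1$2 + A$2$1"
  proof -
    have "4 * w^2 * (4 * (x*y)) = 4 * w^2 * (A$1$2 + A$2$1)"
      unfolding sq unfolding e w4 using C(4,5) R1[of 1 2, simplified] R2[of 1 2, simplified] by algebra
    then show ?thesis using w tr by auto
  qed
  have xz: "4*(x*z) = A$1$3 + A$3$1"
  proof -
    have "4 * w^2 * (4 * (x*z)) = 4 * w^2 * (A$1$3 + A$3$1)"
      unfolding sq unfolding e w4 using C(6,7) R2[of 1 3, simplified] R1[of 1 3, simplified] by algebra
    then show ?thesis using w tr by auto
  qed
  have yz: "4*(y*z) = A$2$3 + A$3$2"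
  proof -
    have "4 * w^2 * (4 * (y*z)) = 4 * w^2 * (A$2$3 + A$3$2)"
      unfolding sq unfolding e w4 using C(8,9) R2[of 2 3, simplified] R1[of 2 3, simplified] by algebra
    then show ?thesis using w tr by auto
  qed
  show ?thesis
  proof
    show "(half_cos A)^2 + x^2 + y^2 + z^2 = 1"
      using xx yy zz w4 unfolding w_def[symmetric] by simp
    show "A = quat_matrix (half_cos A) x y z"
      using xx yy zz w4 xy xz yz e unfolding w_def[symmetric]
      by (simp add: quat_matrix_def vec_eq_iff forall_3 algebra_simps)
  qed
qed

text \<open>The trace of \<open>quat_matrix\<close> is 4w^2 - |q|^2, and the quaternion conj(q) q'
  has the inner product of q and q' as its scalar part.\<close>

lemma trace_quat_transpose_mult:
  "trace (transpose (quat_matrix w x y z) ** quat_matrix w' x' y' z') =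
     4 * (w * w' + x * x' + y * y' + z * z')^2
       - (w^2 + x^2 + y^2 + z^2) * (w'^2 + x'^2 + y'^2 + z'^2)"
  by (simp add: quat_matrix_def trace_3 matrix_matrix_mult_def transpose_def sum_3)
     (simp add: power2_eq_square algebra_simps)

lemma quat_matrix_square:
  "quat_matrix w x y z ** quat_matrix w x y z =
     quat_matrix (w^2 - x^2 - y^2 - z^2) (2 * w * x) (2 * w * y) (2 * w * z)"
  by (simp add: quat_matrix_def matrix_matrix_mult_def sum_3 vec_eq_iff forall_3)
     (simp add: power2_eq_square algebra_simps)

text \<open>By cyclicity of the trace this is the previous trace formula for q' and q^2. The product
  is the cubic term of the orientation field.\<close>

lemma trace_quat_sandwich:
  "trace (quat_matrix w x y z ** transpose (quat_matrix w' x' y' z') ** quat_matrix w x y z) =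
     4 * (2 * w * (w * w' + x * x' + y * y' + z * z') - w' * (w^2 + x^2 + y^2 + z^2))^2
       - (w^2 + x^2 + y^2 + z^2)^2 * (w'^2 + x'^2 + y'^2 + z'^2)"
proof -
  let ?A = "quat_matrix w x y z" and ?B = "quat_matrix w' x' y' z'"
  have "trace (?A ** transpose ?B ** ?A) = trace (transpose ?B ** (?A ** ?A))"
    by (metis trace_mul_sym matrix_mul_assoc)
  then show ?thesis
    unfolding quat_matrix_square trace_quat_transpose_mult
    by (simp add: power2_eq_square algebra_simps)
qed

lemma half_cos_pos_iff: "half_cos A > 0 \<longleftrightarrow> trace A > -1"
  by (auto simp: half_cos_def)

lemma half_cos_square: "trace A \<ge> -1 \<Longrightarrow> 4 * (half_cos A)^2 = 1 + trace A"
  by (simp add: half_cos_def power_divide)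

lemma half_cos_le_1:
  assumes "rotation_matrix A"
  shows "half_cos A \<le> 1"
proof (cases "trace A > -1")
  case True
  obtain x y z where "(half_cos A)^2 + x^2 + y^2 + z^2 = 1"
    using rotation_quaternion[OF assms True] by metis
  then have "(half_cos A)^2 \<le> 1^2"
    by (smt (verit) one_power2 zero_le_power2)
  then show ?thesis
    by (rule power2_le_imp_le) simp
next
  case False
  then have "half_cos A \<le> 0" by (simp add: half_cos_def)
  then show ?thesis by simp
qed

text \<open>With m the cosine of an angle below pi/4, the first bound is the triangle inequality on
  the quaternion sphere, cos(2 arccos m) = 2m^2 - 1. The second is the difference of squares 4b^2 -
  4(2ac - b)^2 for scalar parts a, b and inner product c.\<close>

lemma half_cos_transpose_mult:
  assumes A: "rotation_matrix A" "half_cos A \<ge> m" and B: "rotation_matrix B" "half_cos B \<ge> m"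
    and m: "m > 0" "2 * m^2 > 1"
  shows "half_cos (transpose A ** B) \<ge> 2 * m^2 - 1" (is ?bound)
    and "trace B - trace (A ** transpose B ** A) =
      16 * half_cos A * half_cos (transpose A ** B) *
        (half_cos B - half_cos A * half_cos (transpose A ** B))" (is ?sandwich)
proof -
  let ?a = "half_cos A" and ?b = "half_cos B"
  have tr: "trace C > -1" if "half_cos C \<ge> m" for C
    using that m(1) half_cos_pos_iff[of C] by simp
  obtain x y z where a: "?a^2 + x^2 + y^2 + z^2 = 1" "A = quat_matrix ?a x y z"
    using rotation_quaternion[OF A(1) tr[OF A(2)]] by metis
  obtain x' y' z' where b: "?b^2 + x'^2 + y'^2 + z'^2 = 1" "B = quat_matrix ?b x' y' z'"
    using rotation_quaternion[OF B(1) tr[OF B(2)]] by metis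
  define c where "c = ?a * ?b + x * x' + y * y' + z * z'"
  have ma: "m^2 \<le> ?a^2" "m^2 \<le> ?b^2" "m^2 \<le> ?a * ?b"
    using A(2) B(2) m(1) by (auto intro: power_mono mult_mono simp: power2_eq_square)
  have "0 \<le> (x + x')^2 + (y + y')^2 + (z + z')^2" by simp
  also have "\<dots> = 2 * (x * x' + y * y' + z * z') + (2 - ?a^2 - ?b^2)"
    using a(1) b(1) by (simp add: power2_sum)
  finally have c: "c \<ge> 2 * m^2 - 1"
  proof -
    assume "0 \<le> 2 * (x * x' + y * y' + z * z') + (2 - ?a^2 - ?b^2)"
    then have "2 * (x * x' + y * y' + z * z') \<ge> m^2 + m^2 - 2" using ma(1,2) by simp
    then have "x * x' + y * y' + z * z' \<ge> m^2 - 1" by simp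
    then show ?thesis using ma(3) by (simp add: c_def)
  qed
  have "trace (transpose A ** B) = 4 * c^2 - 1"
    by (subst a(2), subst b(2)) (simp add: trace_quat_transpose_mult a(1) b(1) c_def)
  \<comment> \<open>The square root only determines |c|; the lower bound
    \<open>2 * m^2 - 1 > 0\<close> fixes the sign.\<close>
  then have hc: "half_cos (transpose A ** B) = c"
    using c m by (simp add: half_cos_def real_sqrt_mult)
  show ?bound using hc c by simp
  have "trace (A ** transpose B ** A) = 4 * (2 * ?a * c - ?b)^2 - 1"
    by (subst (1 2) a(2), subst b(2)) (simp add: trace_quat_sandwich a(1) b(1) c_def)
  moreover have "trace B = 4 * ?b^2 - 1"
    using half_cos_square[of B] tr[OF B(2)] by simp
  ultimately show ?sandwich
    unfolding hc by (simp add: power2_eq_square algebra_simps)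
qed

lemma trace_eq_3_minus_dist:
  fixes A B :: "real^3^3"
  assumes "orthogonal_matrix A" "orthogonal_matrix B"
  shows "(norm (A - B))^2 = 6 - 2 * trace (transpose A ** B)"
proof -
  have n: "(norm C)^2 = trace (transpose C ** C)" for C :: "real^3^3"
    by (simp add: power2_norm_eq_inner inner_vec_def trace_3 matrix_matrix_mult_def transpose_def sum_3 algebra_simps)
  have "trace (transpose A ** A) = 3" "trace (transpose B ** B) = 3"
    using assms by (simp_all add: orthogonal_matrix trace_3 mat_def)
  moreover have "trace (transpose (A - B) ** (A - B)) =
      trace (transpose A ** A) + trace (transpose B ** B) - 2 * trace (transpose A ** B)"
    by (simp add: trace_3 matrix_matrix_mult_def transpose_def sum_3 algebra_simps)
  ultimately show ?thesis by (simp add: n)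
qed

text \<open>Coordinate vectors show that the diagonal is positive, so the trace exceeds -1 and a
  quaternion exists. A vector v orthogonal to its vector part is turned by the full rotation angle,
  so the quadratic form at v is the cosine 2w^2 - 1 times |v|^2.\<close>

lemma positive_definite_half_cos:
  assumes A: "rotation_matrix A" and pd: "positive_definite A"
  shows "half_cos A > 0" "2 * (half_cos A)^2 > 1"
proof -
  have d: "A$i$i > 0" for i
  proof -
    have "axis i 1 \<bullet> (A *v axis i 1) > 0"
      using pd by (auto simp: positive_definite_def axis_eq_0_iff)
    then show ?thesis
      by (simp add: matrix_vector_mult_basis column_def inner_axis' )
  qed
  have "trace A > 0" unfolding trace_3 using d[of 1] d[of 2] d[of 3] by linarith
  then have tr: "trace A > -1" by linarith
  obtain x y z where a: "(half_cos A)^2 + x^2 + y^2 + z^2 = 1" "A = quat_matrix (half_cos A) x y z"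
    using rotation_quaternion[OF A tr] by metis
  show "half_cos A > 0" using tr by (simp add: half_cos_pos_iff)
  obtain v :: "real^3" where v: "v \<noteq> 0" "vector [x,y,z] \<bullet> v = 0"
    using orthogonal_to_vector_exists[of "vector [x,y,z] :: real^3"] by (auto simp: orthogonal_def)
  let ?w = "half_cos A"
  have "v \<bullet> (A *v v) = (?w^2 - x^2 - y^2 - z^2) * (v \<bullet> v) + 2 * (vector [x,y,z] \<bullet> v)^2"
    by (subst a(2)) (simp add: quat_matrix_def matrix_vector_mult_def inner_vec_def sum_3 power2_eq_square algebra_simps)
  also have "\<dots> = (2 * ?w^2 - 1) * (v \<bullet> v)"
  proof -
    have "?w^2 - x^2 - y^2 - z^2 = 2 * ?w^2 - 1" using a(1) by linarith
    then show ?thesis using v by simp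
  qed
  finally have "0 < (2 * ?w^2 - 1) * (v \<bullet> v)"
    using pd v by (metis positive_definite_def)
  then show "2 * ?w^2 > 1"
    using inner_ge_zero[of v] by (auto simp: zero_less_mult_iff)
qed

section \<open>Convergence of the orientations\<close>

lemma at_within_atLeast_interior:
  fixes t :: real
  assumes "t > 0"
  shows "at t within {0..} = at t"
  by (rule at_within_interior) (use assms in simp)

text \<open>Solutions are differentiable within \<open>{0..}\<close>, hence only one-sidedly at time
  0. Inside the interval the derivative is two-sided, and at the ends continuity suffices.\<close>

lemma nondecreasing_if_deriv_nonneg_within:
  fixes f :: "real \<Rightarrow> real"
  assumes "0 \<le> a" "a \<le> b"
    and deriv: "\<And>t. a \<le> t \<Longrightarrow> t \<le> b \<Longrightarrow> (f has_real_derivative f' t) (at t within {0..})"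
    and nonneg: "\<And>t. a < t \<Longrightarrow> t < b \<Longrightarrow> 0 \<le> f' t"
  shows "f a \<le> f b"
proof (rule DERIV_nonneg_imp_increasing_open[of a b f])
  show "\<exists>y. DERIV f t :> y \<and> 0 \<le> y" if "a < t" "t < b" for t
    using deriv[of t] nonneg[of t] that assms(1) at_within_atLeast_interior[of t] by auto
  show "continuous_on {a..b} f"
    unfolding continuous_on_eq_continuous_within
  proof
    fix t assume "t \<in> {a..b}"
    then have "continuous (at t within {0..}) f"
      using deriv[of t] DERIV_continuous by auto
    then show "continuous (at t within {a..b}) f"
      by (rule continuous_within_subset) (use assms(1) in auto)
  qed
qed (rule \<open>a \<le> b\<close>)

text \<open>Passage to the frame of R: inserting \<open>R ** transpose R\<close> into the cubic term
  makes every factor relative to R, while the other term collapses because A is orthogonal.\<close>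

lemma trace_transpose_mult_field:
  fixes R A B :: "real^3^3"
  assumes "orthogonal_matrix R" "orthogonal_matrix A"
  shows "trace (transpose R ** (A ** (transpose B ** A - transpose A ** B))) =
    trace ((transpose R ** A) ** transpose (transpose R ** B) ** (transpose R ** A))
      - trace (transpose R ** B)"
proof -
  have R: "R ** transpose R = mat 1" and A: "A ** transpose A = mat 1"
    using assms by (auto simp: orthogonal_matrix_def)
  have d: "X ** (Y - Z) = X ** Y - X ** Z" for X Y Z :: "real^3^3"
    by (simp add: vec_eq_iff matrix_matrix_mult_def sum_subtractf algebra_simps)
  have "transpose R ** (A ** (transpose B ** A - transpose A ** B)) =
      transpose R ** A ** transpose B ** (mat 1 ** A) - transpose R ** (A ** transpose A) ** B"
    by (simp only: d matrix_mul_assoc matrix_mul_rid)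
  also have "\<dots> = (transpose R ** A) ** transpose (transpose R ** B) ** (transpose R ** A) - transpose R ** B"
  proof -
    have "transpose R ** A ** transpose B ** (mat 1 ** A) =
        (transpose R ** A) ** transpose (transpose R ** B) ** (transpose R ** A)"
      unfolding R[symmetric] by (simp only: matrix_transpose_mul transpose_transpose matrix_mul_assoc)
    then show ?thesis by (simp only: A matrix_mul_rid)
  qed
  finally show ?thesis by (simp only: trace_sub)
qed

lemma norm_orthogonal_matrix:
  fixes A :: "real^3^3"
  assumes "orthogonal_matrix A"
  shows "(norm A)^2 = 3"
proof -
  have "(norm A)^2 = (\<Sum>i\<in>UNIV. \<Sum>k\<in>UNIV. A$i$k * A$i$k)"
    by (simp add: power2_norm_eq_inner inner_vec_def)
  then show ?thesis
    by (simp add: orthogonal_matrix_entries[OF assms])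
qed

lemma closed_rotation_matrices: "closed {A :: real^3^3. rotation_matrix A}"
  unfolding rotation_matrix_def orthogonal_matrix det_3 matrix_matrix_mult_def transpose_def
  by (intro closed_Collect_conj closed_Collect_eq continuous_intros)

lemma bounded_linear_trace_transpose_mult:
  "bounded_linear (\<lambda>A :: real^3^3. trace (transpose R ** A))"
  by (rule linear_conv_bounded_linear[THEN iffD1], rule linearI)
    (simp_all add: trace_3 matrix_matrix_mult_def sum_3 algebra_simps)

lemma rotation_matrix_transpose_mult:
  fixes A B :: "real^'n^'n"
  shows "rotation_matrix A \<Longrightarrow> rotation_matrix B \<Longrightarrow> rotation_matrix (transpose A ** B)"
  by (simp add: rotation_matrix_def orthogonal_matrix_mul det_mul)

text \<open>For c the half-angle cosine, the squared distance is 8(1 - c^2), and 1 - c^2 is at most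
  2(1 - c). The linear form fits both the consensus sum and the alignments.\<close>

lemma rotation_matrix_dist:
  assumes "rotation_matrix A" "rotation_matrix B" "half_cos (transpose A ** B) > 0"
  shows "(norm (A - B))^2 \<le> 16 * (1 - half_cos (transpose A ** B))"
proof -
  let ?c = "half_cos (transpose A ** B)"
  have tr: "trace (transpose A ** B) > -1"
    using assms(3) by (simp add: half_cos_def)
  have "?c \<le> 1"
    using half_cos_le_1 rotation_matrix_transpose_mult assms(1,2) by blast
  moreover have "(norm (A - B))^2 = 8 - 8 * ?c^2"
    using trace_eq_3_minus_dist[of A B] assms(1,2) half_cos_square[of "transpose A ** B"] tr
    by (simp add: rotation_matrix_def)
  moreover have "2 * (1 - ?c) - (1 - ?c^2) = (1 - ?c)^2"
    by (simp add: power2_eq_square algebra_simps)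
  ultimately show ?thesis
    using zero_le_power2[of "1 - ?c"] by linarith
qed

lemma transpose_mult_change_frame:
  fixes R A B :: "real^'n^'n"
  assumes "orthogonal_matrix R"
  shows "transpose (transpose R ** A) ** (transpose R ** B) = transpose A ** B"
proof -
  have "transpose (transpose R ** A) ** (transpose R ** B) = transpose A ** (R ** transpose R) ** B"
    by (simp add: matrix_transpose_mul matrix_mul_assoc)
  then show ?thesis using assms by (simp add: orthogonal_matrix_def)
qed

locale orientation_flow =
  fixes E :: "('n::finite \<times> 'n) set" and Q :: "real \<Rightarrow> real^3^3^'n"
  assumes sym: "sym E" and sol: "orientation_solution E Q"
begin

lemma rotation: "t \<ge> 0 \<Longrightarrow> rotation_matrix (Q t $ i)"
  using sol by (auto simp: orientation_solution_def)

text \<open>These are the w_i of the overview; \<open>rel\<close> below gives the c_ij, which do not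
  depend on the frame R.\<close>

definition align :: "real^3^3 \<Rightarrow> real \<Rightarrow> 'n \<Rightarrow> real" where
  "align R t i = half_cos (transpose R ** Q t $ i)"

definition rel :: "real \<Rightarrow> 'n \<Rightarrow> 'n \<Rightarrow> real" where
  "rel t i j = half_cos (transpose (Q t $ i) ** Q t $ j)"

lemma rel_commute: "rel t i j = rel t j i"
proof -
  have "trace (transpose (transpose (Q t $ i) ** Q t $ j)) = trace (transpose (Q t $ j) ** Q t $ i)"
    by (simp add: matrix_transpose_mul)
  moreover have "trace (transpose M) = trace M" for M :: "real^3^3"
    by (simp add: trace_def transpose_def)
  ultimately show ?thesis by (simp add: rel_def half_cos_def)
qed

lemma deriv_trace:
  assumes t: "t \<ge> 0" and R: "rotation_matrix R"
  shows "((\<lambda>t. trace (transpose R ** Q t $ i)) has_real_derivative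
    (\<Sum>j\<in>neighbors E i. trace (transpose R ** Q t $ j)
       - trace ((transpose R ** Q t $ i) ** transpose (transpose R ** Q t $ j) ** (transpose R ** Q t $ i))))
    (at t within {0..})"
proof -
  let ?tr = "\<lambda>A. trace (transpose R ** A)"
  interpret tr: bounded_linear ?tr by (rule bounded_linear_trace_transpose_mult)
  have "(Q has_vector_derivative orientation_field E (Q t)) (at t within {0..})"
    using sol t by (auto simp: orientation_solution_def)
  then have "((\<lambda>t. ?tr (Q t $ i)) has_vector_derivative ?tr (orientation_field E (Q t) $ i)) (at t within {0..})"
    by (intro tr.has_vector_derivative bounded_linear.has_vector_derivative[OF bounded_linear_vec_nth])
  moreover have "?tr (orientation_field E (Q t) $ i) =
    (\<Sum>j\<in>neighbors E i. trace (transpose R ** Q t $ j)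
       - trace ((transpose R ** Q t $ i) ** transpose (transpose R ** Q t $ j) ** (transpose R ** Q t $ i)))"
    using R rotation[OF t]
    by (simp add: orientation_field_def tr.neg tr.sum trace_transpose_mult_field
        rotation_matrix_def flip: sum_negf)
  ultimately show ?thesis
    by (simp add: has_real_derivative_iff_has_vector_derivative)
qed

lemma align_le_1: "t \<ge> 0 \<Longrightarrow> rotation_matrix R \<Longrightarrow> align R t i \<le> 1"
  by (simp add: align_def half_cos_le_1 rotation_matrix_transpose_mult rotation)

lemma rel_le_1: "t \<ge> 0 \<Longrightarrow> rel t i j \<le> 1"
  by (simp add: rel_def half_cos_le_1 rotation_matrix_transpose_mult rotation)

context
  fixes R :: "real^3^3" and m :: real
  assumes R: "rotation_matrix R" and m: "m > 0" "2 * m^2 > 1"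
begin

lemma rel_bounds:
  assumes t: "t \<ge> 0" and al: "align R t i \<ge> m" "align R t j \<ge> m"
  shows "rel t i j \<ge> 2 * m^2 - 1" "rel t i j > 0"
proof -
  have e: "transpose (transpose R ** Q t $ i) ** (transpose R ** Q t $ j) = transpose (Q t $ i) ** Q t $ j"
    using R by (simp add: rotation_matrix_def transpose_mult_change_frame)
  show "rel t i j \<ge> 2 * m^2 - 1"
    using half_cos_transpose_mult(1)[of "transpose R ** Q t $ i" m "transpose R ** Q t $ j"]
      al m R rotation[OF t] rotation_matrix_transpose_mult e
    by (auto simp: align_def rel_def)
  then show "rel t i j > 0" using m by simp
qed

text \<open>The trace is linear in the orientation and is differentiated first. The chain rule for
  the square root then divides by \<open>8 * align R t i\<close>, which removes one factor from each
  term of the trace derivative.\<close>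

lemma deriv_align:
  assumes t: "t \<ge> 0" and al: "\<And>i. align R t i \<ge> m"
  shows "((\<lambda>t. align R t i) has_real_derivative
     (\<Sum>j\<in>neighbors E i. 2 * rel t i j * (align R t j - rel t i j * align R t i))) (at t within {0..})"
proof -
  let ?f = "\<lambda>t. trace (transpose R ** Q t $ i)"
  let ?A = "\<lambda>i. transpose R ** Q t $ i"
  have e: "transpose (?A i) ** ?A j = transpose (Q t $ i) ** Q t $ j" for j
    using R by (simp add: rotation_matrix_def transpose_mult_change_frame)
  have w: "align R t i > 0" using al[of i] m by simp
  then have f: "1 + ?f t > 0" by (simp add: align_def half_cos_def)
  have k: "trace (?A j) - trace (?A i ** transpose (?A j) ** ?A i) =
      8 * align R t i * (2 * rel t i j * (align R t j - rel t i j * align R t i))" for j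
    using half_cos_transpose_mult(2)[OF _ _ _ _ m, of "?A i" "?A j"] al
      rotation_matrix_transpose_mult[OF R rotation[OF t]]
    by (simp add: align_def rel_def e)
  let ?S = "\<Sum>j\<in>neighbors E i. 2 * rel t i j * (align R t j - rel t i j * align R t i)"
  have "(?f has_real_derivative 8 * align R t i * ?S) (at t within {0..})"
    using deriv_trace[OF t R, of i] unfolding k sum_distrib_left .
  from DERIV_add[OF DERIV_const[of 1] this]
  have "((\<lambda>t. 1 + ?f t) has_real_derivative 8 * align R t i * ?S) (at t within {0..})"
    by (simp only: add_0_left)
  from DERIV_cdivide[OF DERIV_chain2[OF DERIV_real_sqrt[OF f] this], of 2]
  have "((\<lambda>t. align R t i) has_real_derivative
     (inverse (sqrt (1 + ?f t)) / 2 * (8 * align R t i * ?S)) / 2) (at t within {0..})"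
    by (simp only: align_def half_cos_def)
  moreover have "sqrt (1 + ?f t) = 2 * align R t i" by (simp add: align_def half_cos_def)
  then have "inverse (sqrt (1 + ?f t)) / 2 * (8 * align R t i * ?S) / 2 = ?S"
    using w by simp
  ultimately show ?thesis by (simp only:)
qed

end

lemma continuous_on_align:
  assumes "rotation_matrix R"
  shows "continuous_on {0..} (\<lambda>t. align R t i)"
proof -
  have "continuous_on {0..} (\<lambda>t. trace (transpose R ** Q t $ i))"
    by (rule DERIV_continuous_on[OF deriv_trace[OF _ assms]]) auto
  then show ?thesis
    unfolding align_def half_cos_def by (intro continuous_intros) auto
qed

text \<open>The derivative formula is only available while all alignments stay in the range
  \<open>2 * w^2 > 1\<close>, so the proof looks at the first time T at which some alignment is down
  to a level m' < m. Until then the excess over m' of that agent shrinks at most exponentially and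
  cannot reach 0.\<close>

lemma align_min_nondecreasing:
  assumes R: "rotation_matrix R" and m: "m > 0" "2 * m^2 > 1"
    and t0: "t0 \<ge> 0" "\<And>i. align R t0 i \<ge> m" and t: "t \<ge> t0"
  shows "align R t i \<ge> m"
proof (rule ccontr)
  assume less: "\<not> align R t i \<ge> m"
  \<comment> \<open>This average lies strictly below m, above the supposed low value, and above
    \<open>sqrt (1/2)\<close>, so the estimates still apply at level m'.\<close>
  define m' where "m' = (max (align R t i) (sqrt (1/2)) + m) / 2"
  have "sqrt (1/2) < m"
    by (rule real_less_lsqrt) (use m in auto)
  then have m': "m' < m" "align R t i < m'" "sqrt (1/2) < m'"
    using less by (auto simp: m'_def max_def)
  then have "(sqrt (1/2))^2 < m'^2"
    by (intro power_strict_mono) auto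
  then have m'sq: "m' > 0" "2 * m'^2 > 1"
    using m'(3) by (auto intro: less_trans[of 0 "sqrt (1/2)"])
  define S where "S = (\<Union>j. {s\<in>{t0..t}. align R s j \<le> m'})"
  have "compact S"
    unfolding S_def
  proof (intro compact_UN)
    fix j
    have "continuous_on {t0..t} (\<lambda>s. align R s j)"
      by (rule continuous_on_subset[OF continuous_on_align[OF R]]) (use t0 in auto)
    then have "closed {s\<in>{t0..t}. align R s j \<le> m'}"
      by (rule continuous_on_closed_Collect_le) (auto intro: continuous_on_const)
    then have "compact ({t0..t} \<inter> {s\<in>{t0..t}. align R s j \<le> m'})"
      by (intro compact_Int_closed) auto
    then show "compact {s\<in>{t0..t}. align R s j \<le> m'}"
      by (rule back_subst) auto
  qed auto
  moreover have "S \<noteq> {}" using m'(2) t by (auto simp: S_def intro!: exI[of _ t] exI[of _ i])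
  ultimately obtain T where T: "T \<in> S" "\<And>s. s \<in> S \<Longrightarrow> T \<le> s"
    using compact_attains_inf by metis
  then obtain j where j: "align R T j \<le> m'" and Tt: "t0 \<le> T" "T \<le> t" by (auto simp: S_def)
  have above: "align R s k > m'" if "t0 \<le> s" "s < T" for s k
  proof (rule ccontr)
    assume "\<not> align R s k > m'"
    then have "s \<in> S" using that Tt by (auto simp: S_def intro!: exI[of _ k])
    then show False using T(2)[of s] that by simp
  qed
  \<comment> \<open>Before T, each neighbor contributes at least \<open>- 2 * (w - m')\<close> to
    the derivative, since its own alignment is above m' and \<open>rel\<close> is at most 1. Summing
    over the neighbors gives the rate K.\<close>
  define K where "K = 2 * real (card (neighbors E j))"
  define w where "w s = align R s j" for s
  define w' where "w' s = (\<Sum>k\<in>neighbors E j. 2 * rel s j k * (align R s k - rel s j k * align R s j))" for s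
  have cont: "continuous_on {t0..T} (\<lambda>s. exp (K * s) * (w s - m'))"
    unfolding w_def
    by (intro continuous_intros continuous_on_subset[OF continuous_on_align[OF R]]) (use t0 in auto)
  have "exp (K * t0) * (w t0 - m') \<le> exp (K * T) * (w T - m')"
  proof (rule DERIV_nonneg_imp_increasing_open[OF Tt(1) _ cont])
    fix s assume s: "t0 < s" "s < T"
    then have s0: "s > 0" using t0 by simp
    have al: "align R s k \<ge> m'" for k using above[of s k] s by simp
    have "(w has_real_derivative w' s) (at s)"
      using deriv_align[OF R m'sq less_imp_le[OF s0] al] at_within_atLeast_interior[OF s0]
      by (simp add: w_def[abs_def] w'_def)
    then have d: "((\<lambda>s. exp (K * s) * (w s - m')) has_real_derivative
        exp (K * s) * (K * (w s - m') + w' s)) (at s)"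
      by (auto intro!: derivative_eq_intros simp: algebra_simps)
    have "2 * (m' - w s) \<le> 2 * rel s j k * (align R s k - rel s j k * align R s j)" for k
    proof -
      have b: "rel s j k > 0" "rel s j k \<le> 1"
        using rel_bounds(2)[OF R m'sq] al s0 rel_le_1 by auto
      have "rel s j k * align R s j \<le> 1 * align R s j"
        by (rule mult_right_mono) (use b al[of j] m'sq in linarith)+
      then have "m' - w s \<le> align R s k - rel s j k * align R s j"
        using al[of k] unfolding w_def by linarith
      then have "rel s j k * (m' - w s) \<le> rel s j k * (align R s k - rel s j k * align R s j)"
        by (rule mult_left_mono) (use b in linarith)
      moreover have "1 * (m' - w s) \<le> rel s j k * (m' - w s)"
        by (rule mult_right_mono_neg) (use b al[of j] in \<open>simp_all add: w_def\<close>)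
      ultimately show ?thesis by (simp add: mult.assoc)
    qed
    then have "(\<Sum>k\<in>neighbors E j. 2 * (m' - w s)) \<le> w' s"
      unfolding w'_def by (intro sum_mono)
    then have "K * (w s - m') + w' s \<ge> 0" by (simp add: K_def algebra_simps)
    with d show "\<exists>y. ((\<lambda>s. exp (K * s) * (w s - m')) has_real_derivative y) (at s) \<and> 0 \<le> y"
      by (intro exI conjI) (assumption, simp)
  qed
  moreover have "w T - m' \<le> 0" "w t0 - m' > 0"
    using j t0(2)[of j] m' by (auto simp: w_def)
  moreover from this have "exp (K * T) * (w T - m') \<le> 0" "exp (K * t0) * (w t0 - m') > 0"
    by (auto intro: mult_nonneg_nonpos)
  ultimately show False by linarith
qed

end

lemma sum_neighbors_swap:
  assumes "sym E"
  shows "(\<Sum>i\<in>UNIV. \<Sum>j\<in>neighbors E i. f i j) = (\<Sum>i\<in>UNIV. \<Sum>j\<in>neighbors E i. f j (i::'n::finite))"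
proof -
  have "(\<Sum>i\<in>UNIV. \<Sum>j\<in>neighbors E i. f i j) = (\<Sum>i\<in>UNIV. \<Sum>j\<in>UNIV. if (i, j) \<in> E then f i j else 0)"
    by (simp add: neighbors_def sum.If_cases)
  also have "\<dots> = (\<Sum>i\<in>UNIV. \<Sum>j\<in>UNIV. if (j, i) \<in> E then f j i else 0)"
    by (rule sum.swap)
  also have "\<dots> = (\<Sum>i\<in>UNIV. \<Sum>j\<in>neighbors E i. f j i)"
  proof -
    have "(j, i) \<in> E \<longleftrightarrow> (i, j) \<in> E" for i j using assms by (auto dest: symD)
    then show ?thesis by (simp add: neighbors_def sum.If_cases)
  qed
  finally show ?thesis .
qed

context orientation_flow
begin

lemma near_consensus:
  assumes R: "rotation_matrix R" and m: "m > 0" "2 * m^2 > 1" and al0: "\<And>i. align R 0 i \<ge> m"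
    and T: "T \<ge> 0" and \<epsilon>: "\<epsilon> > 0"
  shows "\<exists>t\<ge>T. (\<Sum>i\<in>UNIV. \<Sum>j\<in>neighbors E i. 1 - rel t i j) < \<epsilon>"
proof (rule ccontr)
  assume "\<not> ?thesis"
  then have far: "(\<Sum>i\<in>UNIV. \<Sum>j\<in>neighbors E i. 1 - rel t i j) \<ge> \<epsilon>" if "t \<ge> T" for t
    using that by force
  have al: "align R t i \<ge> m" if "t \<ge> 0" for t i
    using align_min_nondecreasing[OF R m _ al0, of t] that by simp
  \<comment> \<open>A lower bound for the weights 2 c_ij w_i, from c_ij \<ge> 2m^2 - 1 and w_i \<ge>
    m.\<close>
  define \<kappa> where "\<kappa> = 2 * (2 * m^2 - 1) * m"
  have \<kappa>: "\<kappa> > 0" using m by (simp add: \<kappa>_def)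
  define F' where "F' t = (\<Sum>i\<in>UNIV. \<Sum>j\<in>neighbors E i.
      2 * rel t i j * (align R t j - rel t i j * align R t i))" for t
  have deriv: "((\<lambda>t. (\<Sum>i\<in>UNIV. align R t i) - \<kappa> * \<epsilon> * t) has_real_derivative (F' t - \<kappa> * \<epsilon>)) (at t within {0..})"
    if "t \<ge> 0" for t
  proof -
    have "((\<lambda>t. \<Sum>i\<in>UNIV. align R t i) has_real_derivative F' t) (at t within {0..})"
      unfolding F'_def by (intro DERIV_sum deriv_align[OF R m that al[OF that]])
    moreover have "((\<lambda>t. \<kappa> * \<epsilon> * t) has_real_derivative \<kappa> * \<epsilon>) (at t within {0..})"
      by (auto intro!: derivative_eq_intros)
    ultimately show ?thesis by (rule DERIV_diff)
  qed
  have F': "F' t \<ge> \<kappa> * \<epsilon>" if t: "t \<ge> T" for t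
  proof -
    have t0: "t \<ge> 0" using t T by simp
    let ?g = "\<lambda>i j. 2 * rel t i j * align R t j"
    \<comment> \<open>Since \<open>rel\<close> is symmetric, the consensus terms cancel in the sum over all agents.\<close>
    have "(\<Sum>i\<in>UNIV. \<Sum>j\<in>neighbors E i. ?g i j) = (\<Sum>i\<in>UNIV. \<Sum>j\<in>neighbors E i. ?g j i)"
      by (rule sum_neighbors_swap[OF sym])
    then have "F' t = (\<Sum>i\<in>UNIV. \<Sum>j\<in>neighbors E i. 2 * rel t i j * align R t i * (1 - rel t i j))"
      unfolding F'_def by (simp add: right_diff_distrib sum_subtractf rel_commute mult_ac)
    moreover have "\<kappa> * (\<Sum>i\<in>UNIV. \<Sum>j\<in>neighbors E i. 1 - rel t i j) \<le> \<dots>"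
      unfolding sum_distrib_left
    proof (intro sum_mono mult_right_mono)
      fix i j
      show "\<kappa> \<le> 2 * rel t i j * align R t i"
        unfolding \<kappa>_def using rel_bounds[OF R m t0 al al, of i j] t0 al[OF t0, of i] m
        by (intro mult_mono) auto
      show "0 \<le> 1 - rel t i j" using rel_le_1[OF t0] by simp
    qed
    moreover have "\<kappa> * \<epsilon> \<le> \<kappa> * (\<Sum>i\<in>UNIV. \<Sum>j\<in>neighbors E i. 1 - rel t i j)"
      using far[OF t] \<kappa> by (intro mult_left_mono) auto
    ultimately show ?thesis by linarith
  qed
  \<comment> \<open>At speed at least \<open>\<kappa> * \<epsilon>\<close> the sum would gain
    \<open>CARD('n) + 1\<close> by this time, although it starts nonnegative and never exceeds
    \<open>CARD('n)\<close>.\<close>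
  define T1 where "T1 = T + (real CARD('n) + 1) / (\<kappa> * \<epsilon>)"
  have T1: "T \<le> T1" using \<kappa> \<epsilon> by (simp add: T1_def)
  have "(\<Sum>i\<in>UNIV. align R T i) - \<kappa> * \<epsilon> * T \<le> (\<Sum>i\<in>UNIV. align R T1 i) - \<kappa> * \<epsilon> * T1"
  proof (rule nondecreasing_if_deriv_nonneg_within[where f = "\<lambda>t. (\<Sum>i\<in>UNIV. align R t i) - \<kappa> * \<epsilon> * t", OF T T1])
    show "((\<lambda>t. (\<Sum>i\<in>UNIV. align R t i) - \<kappa> * \<epsilon> * t) has_real_derivative (F' t - \<kappa> * \<epsilon>)) (at t within {0..})"
      if "T \<le> t" for t using deriv[of t] that T by simp
    show "0 \<le> F' t - \<kappa> * \<epsilon>" if "T < t" for t using F'[of t] that by simp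
  qed
  moreover have "\<kappa> * \<epsilon> * T1 = \<kappa> * \<epsilon> * T + (real CARD('n) + 1)"
    using \<kappa> \<epsilon> unfolding T1_def distrib_left[of _ T] by (simp only: times_divide_eq_right) simp
  moreover have "(\<Sum>i\<in>UNIV. align R T1 i) \<le> (\<Sum>i\<in>(UNIV::'n set). 1)"
    by (intro sum_mono align_le_1) (use T T1 R in auto)
  moreover have "(\<Sum>i\<in>UNIV. align R T i) \<ge> 0"
    by (intro sum_nonneg) (use al T m in \<open>meson less_imp_le order_trans\<close>)
  ultimately show False by simp
qed

text \<open>Connectedness enters as the statement that functions constant along edges are constant.
  Rigidity yields it in this form, and it is applied to the accumulation point, whose components
  agree along edges.\<close>

lemma orientations_converge:
  assumes connected: "\<And>(f :: 'n \<Rightarrow> real^3^3) i j. (\<And>i j. (i, j) \<in> E \<Longrightarrow> f i = f j) \<Longrightarrow> f i = f j"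
    and R: "rotation_matrix R" and m: "m > 0" "2 * m^2 > 1" and al0: "\<And>i. align R 0 i \<ge> m"
  shows "\<exists>L. rotation_matrix L \<and> (\<forall>i. ((\<lambda>t. Q t $ i) \<longlongrightarrow> L) at_top)"
proof -
  have al: "align R t i \<ge> m" if "t \<ge> 0" for t i
    using align_min_nondecreasing[OF R m _ al0, of t] that by simp
  have "\<exists>t\<ge>real k. (\<Sum>i\<in>UNIV. \<Sum>j\<in>neighbors E i. 1 - rel t i j) < 1 / real (Suc k)" for k
    by (rule near_consensus[OF R m al0]) auto
  then obtain \<tau> where \<tau>: "\<And>k. \<tau> k \<ge> real k"
    and small: "\<And>k. (\<Sum>i\<in>UNIV. \<Sum>j\<in>neighbors E i. 1 - rel (\<tau> k) i j) < 1 / real (Suc k)"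
    by metis
  have \<tau>0: "\<tau> k \<ge> 0" for k using \<tau>[of k] by linarith
  have bounded: "bounded (range (\<lambda>k. Q (\<tau> k)))"
    unfolding bounded_iff
  proof (intro exI ballI)
    fix A assume "A \<in> range (\<lambda>k. Q (\<tau> k))"
    then obtain k where A: "A = Q (\<tau> k)" by auto
    have "norm A \<le> (\<Sum>i\<in>UNIV. norm (A $ i))" unfolding norm_vec_def
      by (rule L2_set_le_sum) auto
    also have "\<dots> = (\<Sum>i\<in>(UNIV::'n set). sqrt 3)"
    proof (rule sum.cong)
      fix i
      have "orthogonal_matrix (A $ i)" using rotation[OF \<tau>0] A by (auto simp: rotation_matrix_def)
      then show "norm (A $ i) = sqrt 3"
        using norm_orthogonal_matrix by (metis norm_ge_zero real_sqrt_unique)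
    qed simp
    finally show "norm A \<le> (\<Sum>i\<in>(UNIV::'n set). sqrt 3)" .
  qed
  obtain L r where r: "strict_mono r" and "((\<lambda>k. Q (\<tau> k)) \<circ> r) \<longlonglongrightarrow> L"
    using bounded_imp_convergent_subsequence[OF bounded] by metis
  then have L: "(\<lambda>k. Q (\<tau> (r k)) $ i) \<longlonglongrightarrow> L $ i" for i
    by (auto simp: o_def intro: tendsto_vec_nth)
  have edge: "L $ i = L $ j" if "(i, j) \<in> E" for i j
  proof -
    have "(\<lambda>k. (norm (Q (\<tau> (r k)) $ i - Q (\<tau> (r k)) $ j))\<^sup>2) \<longlonglongrightarrow> 0"
    proof (rule tendsto_sandwich[OF _ _ tendsto_const])
      show "\<forall>\<^sub>F k in sequentially. (norm (Q (\<tau> (r k)) $ i - Q (\<tau> (r k)) $ j))\<^sup>2 \<le> 16 * (1 / real (Suc k))"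
      proof (rule always_eventually, rule allI)
        fix k
        let ?t = "\<tau> (r k)"
        have "(norm (Q ?t $ i - Q ?t $ j))\<^sup>2 \<le> 16 * (1 - rel ?t i j)"
          using rotation_matrix_dist[OF rotation[OF \<tau>0] rotation[OF \<tau>0]]
            rel_bounds(2)[OF R m \<tau>0 al[OF \<tau>0] al[OF \<tau>0]] by (simp add: rel_def)
        also have "1 - rel ?t i j \<le> (\<Sum>j\<in>neighbors E i. 1 - rel ?t i j)"
          by (rule member_le_sum) (use that rel_le_1[OF \<tau>0] in \<open>auto simp: neighbors_def\<close>)
        also have "\<dots> \<le> (\<Sum>i\<in>UNIV. \<Sum>j\<in>neighbors E i. 1 - rel ?t i j)"
          by (rule member_le_sum[where f = "\<lambda>i. \<Sum>j\<in>neighbors E i. 1 - rel ?t i j"])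
            (use rel_le_1[OF \<tau>0] in \<open>auto intro!: sum_nonneg\<close>)
        also have "\<dots> \<le> 1 / real (Suc (r k))" using small[of "r k"] by simp
        also have "\<dots> \<le> 1 / real (Suc k)"
          using seq_suble[OF r, of k] by (intro divide_left_mono) auto
        finally show "(norm (Q ?t $ i - Q ?t $ j))\<^sup>2 \<le> 16 * (1 / real (Suc k))" by simp
      qed
      show "(\<lambda>k. 16 * (1 / real (Suc k))) \<longlonglongrightarrow> 0"
        using tendsto_mult_right_zero[OF LIMSEQ_inverse_real_of_nat, of 16] by (simp add: inverse_eq_divide)
    qed simp
    moreover have "(\<lambda>k. (norm (Q (\<tau> (r k)) $ i - Q (\<tau> (r k)) $ j))\<^sup>2) \<longlonglongrightarrow> (norm (L $ i - L $ j))\<^sup>2"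
      by (intro tendsto_intros L)
    ultimately have "(norm (L $ i - L $ j))\<^sup>2 = 0" using LIMSEQ_unique by blast
    then show ?thesis by simp
  qed
  obtain P where P: "\<And>i. L $ i = P" using connected[of "\<lambda>i. L $ i"] edge by metis
  have rotP: "rotation_matrix P"
    using closed_sequentially[OF closed_rotation_matrices _ L] P rotation[OF \<tau>0] by auto
  have lim: "(\<lambda>k. align P (\<tau> (r k)) i) \<longlonglongrightarrow> 1" for i
  proof -
    have "(\<lambda>k. align P (\<tau> (r k)) i) \<longlonglongrightarrow> half_cos (transpose P ** P)"
      unfolding align_def half_cos_def
      using bounded_linear.tendsto[OF bounded_linear_trace_transpose_mult L[of i, unfolded P]]
      by (intro tendsto_intros) auto
    moreover have "half_cos (transpose P ** P) = 1"
      using rotP by (simp add: rotation_matrix_def orthogonal_matrix half_cos_def trace_3 mat_def)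
    ultimately show ?thesis by simp
  qed
  have "((\<lambda>t. Q t $ i) \<longlongrightarrow> P) at_top" for i
  proof (rule tendstoI)
    fix e :: real assume e: "e > 0"
    define q where "q = e^2"
    have q: "q > 0" using e by (simp add: q_def)
    \<comment> \<open>The bound 3/4 guarantees \<open>2 * \<mu>^2 > 1\<close>; the other entry makes
      16(1 - \<mu>) at most q/2, so that \<open>rotation_matrix_dist\<close> yields a distance below
      e.\<close>
    define \<mu> where "\<mu> = max (3/4) (1 - q / 32)"
    have \<mu>: "\<mu> < 1" "\<mu> > 0" "2 * \<mu>^2 > 1" "16 * (1 - \<mu>) < q"
    proof -
      show "\<mu> < 1" "\<mu> > 0" using q by (auto simp: \<mu>_def)
      have "(3/4)^2 \<le> \<mu>^2" by (rule power_mono) (auto simp: \<mu>_def)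
      then show "2 * \<mu>^2 > 1" by (simp add: power2_eq_square)
      have "\<mu> \<ge> 1 - q / 32" unfolding \<mu>_def by (rule max.cobounded2)
      then show "16 * (1 - \<mu>) < q" using q by simp
    qed
    have "\<forall>\<^sub>F k in sequentially. \<forall>i. align P (\<tau> (r k)) i > \<mu>"
      using lim \<mu>(1) by (intro eventually_all_finite order_tendstoD(1)) auto
    then obtain k where k: "\<And>i. align P (\<tau> (r k)) i > \<mu>"
      by (auto dest!: eventually_happens'[OF sequentially_bot])
    have "dist (Q t $ i) P < e" if t: "t \<ge> \<tau> (r k)" for t
    proof -
      have t0: "t \<ge> 0" using t \<tau>0 order_trans by blast
      have al: "align P t i \<ge> \<mu>"
        using align_min_nondecreasing[OF rotP \<mu>(2,3) \<tau>0 less_imp_le[OF k] t] .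
      have "(norm (P - Q t $ i))\<^sup>2 \<le> 16 * (1 - align P t i)"
        using rotation_matrix_dist[OF rotP rotation[OF t0]] al \<mu>(2) by (simp add: align_def)
      also have "\<dots> < q" using al \<mu>(4) by simp
      finally have "norm (P - Q t $ i) < e"
        using e unfolding q_def by (intro power2_less_imp_less[of _ e]) auto
      then show ?thesis by (simp add: dist_norm norm_minus_commute)
    qed
    then show "\<forall>\<^sub>F t in at_top. dist (Q t $ i) P < e"
      by (auto simp: eventually_at_top_linorder)
  qed
  then show ?thesis using rotP by blast
qed

end

section \<open>Bearing rigidity and the target configuration\<close>

lemma has_derivative_vec_componentwise:
  fixes f :: "'a::real_normed_vector \<Rightarrow> ('b::euclidean_space)^'n"
  assumes "\<And>e. ((\<lambda>x. f x $ e) has_derivative (\<lambda>h. f' h $ e)) (at x)"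
  shows "(f has_derivative f') (at x)"
  unfolding has_derivative_componentwise_within[of f]
proof
  fix b :: "'b^'n" assume "b \<in> Basis"
  then obtain e u where "b = axis e u" by (auto simp: Basis_vec_def)
  then show "((\<lambda>x. f x \<bullet> b) has_derivative (\<lambda>h. f' h \<bullet> b)) (at x)"
    using has_derivative_inner_left[OF assms[of e], of u] by (simp add: inner_axis)
qed

lemma normalize_has_derivative:
  fixes e :: "'a::real_inner"
  assumes "e \<noteq> 0"
  shows "((\<lambda>x. x /\<^sub>R norm x) has_derivative
    (\<lambda>h. inverse (norm e) *\<^sub>R h - (inverse (norm e) * (h \<bullet> sgn e) * inverse (norm e)) *\<^sub>R e)) (at e)"
proof -
  have "((\<lambda>x. inverse (norm x)) has_derivative
      (\<lambda>h. - (inverse (norm e) * (h \<bullet> sgn e) * inverse (norm e)))) (at e)"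
    by (rule Deriv.has_derivative_inverse[OF _ has_derivative_norm[OF assms]]) (use assms in simp)
  from has_derivative_scaleR[OF this has_derivative_ident]
  show ?thesis by simp
qed

text \<open>Changing an edge along itself does not turn it to first order. The derivative D is
  exhibited explicitly because \<open>frechet_derivative\<close> is a choice operator, which carries
  information only once some derivative is known.\<close>

lemma stacked_bearings_derivative_zero:
  assumes cf: "collision_free E q" and A: "A \<subseteq> E"
    and par: "\<And>i j. (i, j) \<in> E \<Longrightarrow> \<exists>l. dq $ j - dq $ i = l *\<^sub>R (q $ j - q $ i)"
  shows "frechet_derivative (stacked_bearings A) (at q) dq = 0"
proof -
  let ?d = "\<lambda>p e. p $ snd e - p $ fst e :: real^3"
  define D where "D = (\<lambda>h. \<chi> e. if e \<in> A then
     inverse (norm (?d q e)) *\<^sub>R ?d h e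
       - (inverse (norm (?d q e)) * (?d h e \<bullet> sgn (?d q e)) * inverse (norm (?d q e))) *\<^sub>R ?d q e else 0)"
  have "(stacked_bearings A has_derivative D) (at q)"
  proof (rule has_derivative_vec_componentwise)
    fix e
    show "((\<lambda>x. stacked_bearings A x $ e) has_derivative (\<lambda>h. D h $ e)) (at q)"
    proof (cases "e \<in> A")
      case True
      then have ne: "?d q e \<noteq> 0" using cf A by (cases e) (force simp: collision_free_def)
      have "bounded_linear (\<lambda>p. ?d p e)"
        by (intro bounded_linear_sub bounded_linear_vec_nth)
      from has_derivative_compose[OF bounded_linear_imp_has_derivative[OF this] normalize_has_derivative[OF ne]]
      show ?thesis using True by (simp add: stacked_bearings_def bearing_def D_def)
    next
      case False
      then show ?thesis by (simp add: stacked_bearings_def D_def)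
    qed
  qed
  then have "frechet_derivative (stacked_bearings A) (at q) = D"
    using frechet_derivative_at by metis
  moreover have "D dq $ e = 0" for e
  proof (cases "e \<in> A")
    case True
    then obtain l where l: "?d dq e = l *\<^sub>R ?d q e"
      using par[of "fst e" "snd e"] A by auto
    have ne: "?d q e \<noteq> 0" using True cf A by (cases e) (force simp: collision_free_def)
    have "?d q e \<bullet> sgn (?d q e) = norm (?d q e)"
      using ne by (simp add: sgn_div_norm dot_square_norm power2_eq_square)
    then show ?thesis using True ne by (simp add: D_def l)
  next
    case False
    then show ?thesis by (simp add: D_def)
  qed
  ultimately show ?thesis by (simp add: vec_eq_iff)
qed

text \<open>The form in which rigidity is applied from here on, free of derivatives and of the
  choice of an edge orientation.\<close>

lemma inf_bearing_rigid_kernel: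
  assumes rigid: "inf_bearing_rigid E q" and cf: "collision_free E q"
    and par: "\<And>i j. (i, j) \<in> E \<Longrightarrow> \<exists>l. dq $ j - dq $ i = l *\<^sub>R (q $ j - q $ i)"
  shows "\<exists>x \<alpha>. dq = stack_const x + \<alpha> *\<^sub>R q"
proof -
  obtain A where A: "edge_orientation E A"
    and kernel: "\<And>dq. frechet_derivative (stacked_bearings A) (at q) dq = 0 \<Longrightarrow>
          \<exists>x \<alpha>. dq = stack_const x + \<alpha> *\<^sub>R q"
    using rigid by (auto simp: inf_bearing_rigid_def)
  have "A \<subseteq> E" using A by (auto simp: edge_orientation_def)
  then show ?thesis
    using kernel stacked_bearings_derivative_zero[OF cf _ par] by blast
qed

text \<open>Otherwise the vertices sharing the value \<open>f a\<close> could be shifted rigidly by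
  v without affecting any edge. Taking v orthogonal to \<open>q $ a - q $ b\<close> rules out that
  this shift is a translation plus a dilation.\<close>

lemma inf_bearing_rigid_connected:
  assumes rigid: "inf_bearing_rigid E q" and cf: "collision_free E q"
    and edge: "\<And>i j. (i, j) \<in> E \<Longrightarrow> f i = f j"
  shows "f a = f b"
proof (rule ccontr)
  assume ne: "f a \<noteq> f b"
  obtain v where v: "v \<noteq> 0" "(q $ a - q $ b) \<bullet> v = 0"
    using orthogonal_to_vector_exists[of "q $ a - q $ b"] by (auto simp: orthogonal_def)
  define dq where "dq = (\<chi> i. if f i = f a then v else 0)"
  have "\<exists>l. dq $ j - dq $ i = l *\<^sub>R (q $ j - q $ i)" if "(i, j) \<in> E" for i j
    using edge[OF that] by (intro exI[of _ 0]) (simp add: dq_def)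
  then obtain x \<alpha> where "dq = stack_const x + \<alpha> *\<^sub>R q"
    using inf_bearing_rigid_kernel[OF rigid cf] by blast
  then have "dq $ a - dq $ b = \<alpha> *\<^sub>R (q $ a - q $ b)"
    by (simp add: stack_const_def scaleR_diff_right)
  then have "v = \<alpha> *\<^sub>R (q $ a - q $ b)" using ne by (simp add: dq_def)
  then have "v \<bullet> v = \<alpha> * ((q $ a - q $ b) \<bullet> v)" by (metis inner_scaleR_left)
  then show False using v by simp
qed

definition rotate_config :: "real^3^3 \<Rightarrow> real^3^'n \<Rightarrow> real^3^'n" where
  "rotate_config R p = (\<chi> i. R *v p $ i)"

lemma norm_orthogonal_matrix_mult:
  fixes R :: "real^'n^'n"
  shows "orthogonal_matrix R \<Longrightarrow> norm (R *v x) = norm x"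
  using orthogonal_transformation_matrix[of "(*v) R"] orthogonal_transformation_norm[of "(*v) R"]
  by simp

lemma satisfies_bearings_rotate:
  assumes R: "orthogonal_matrix R" and p: "satisfies_bearings E g p"
  shows "satisfies_bearings E (\<lambda>i j. R *v g i j) (rotate_config R p)"
proof -
  have b: "bearing (rotate_config R p) i j = R *v bearing p i j" for i j
    by (simp add: bearing_def rotate_config_def norm_orthogonal_matrix_mult[OF R]
        matrix_vector_mult_scaleR flip: matrix_vector_mult_diff_distrib)
  have "R *v x = R *v y \<Longrightarrow> x = y" for x y
    using norm_orthogonal_matrix_mult[OF R, of "x - y"] by (simp add: matrix_vector_mult_diff_distrib)
  then have "collision_free E (rotate_config R p)"
    using p by (auto simp: satisfies_bearings_def collision_free_def rotate_config_def)
  then show ?thesis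
    using p b by (auto simp: satisfies_bearings_def)
qed

lemma rotate_config_transpose:
  assumes "orthogonal_matrix R"
  shows "rotate_config R (rotate_config (transpose R) p) = p"
proof -
  have "R *v (transpose R *v x) = x" for x
    using assms by (simp only: matrix_vector_mul_assoc orthogonal_matrix_def matrix_vector_mul_lid)
  then show ?thesis by (simp only: rotate_config_def vec_lambda_beta vec_lambda_eta)
qed

text \<open>Rigidity is assumed for formations with bearings g, whereas the target has bearings R g.
  Both the formation and the displacement are rotated back, and the resulting trivial motion is
  rotated forward again.\<close>

lemma rotated_bearings_kernel:
  assumes R: "orthogonal_matrix R" and rigid: "ensures_inf_bearing_rigidity E g"
    and p: "satisfies_bearings E (\<lambda>i j. R *v g i j) p"
    and par: "\<And>i j. (i, j) \<in> E \<Longrightarrow> \<exists>l. dq $ j - dq $ i = l *\<^sub>R (p $ j - p $ i)"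
  shows "\<exists>x \<alpha>. dq = stack_const x + \<alpha> *\<^sub>R p"
proof -
  have RT: "orthogonal_matrix (transpose R)" using R by simp
  let ?p = "rotate_config (transpose R) p" and ?dq = "rotate_config (transpose R) dq"
  have "satisfies_bearings E g ?p"
    using satisfies_bearings_rotate[OF RT p] R
    by (simp add: matrix_vector_mul_assoc orthogonal_matrix del: transpose_matrix_vector)
  then have "inf_bearing_rigid E ?p" "collision_free E ?p"
    using rigid by (auto simp: ensures_inf_bearing_rigidity_def satisfies_bearings_def)
  moreover have "\<exists>l. ?dq $ j - ?dq $ i = l *\<^sub>R (?p $ j - ?p $ i)" if "(i, j) \<in> E" for i j
    using par[OF that]
    by (auto simp: rotate_config_def matrix_vector_mult_scaleR simp del: transpose_matrix_vector
        simp flip: matrix_vector_mult_diff_distrib)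
  ultimately obtain x \<alpha> where "?dq = stack_const x + \<alpha> *\<^sub>R ?p"
    using inf_bearing_rigid_kernel by blast
  then have "rotate_config R ?dq = rotate_config R (stack_const x + \<alpha> *\<^sub>R ?p)" by simp
  also have "\<dots> = stack_const (R *v x) + \<alpha> *\<^sub>R rotate_config R ?p"
    by (simp add: rotate_config_def stack_const_def vec_eq_iff matrix_vector_right_distrib matrix_vector_mult_scaleR)
  finally show ?thesis
    unfolding rotate_config_transpose[OF R] by blast
qed

lemma centroid_affine: "centroid (stack_const x + \<alpha> *\<^sub>R (q :: real^3^'n::finite)) = x + \<alpha> *\<^sub>R centroid q"
  by (simp add: centroid_def stack_const_def sum.distrib scaleR_right.sum[symmetric] scaleR_add_right
      sum_constant_scaleR mult.commute del: sum_constant)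

lemma config_scale_affine:
  "config_scale (stack_const x + \<alpha> *\<^sub>R (q :: real^3^'n::finite)) = \<bar>\<alpha>\<bar> * config_scale q"
proof -
  have "norm ((stack_const x + \<alpha> *\<^sub>R q) $ i - centroid (stack_const x + \<alpha> *\<^sub>R q)) = \<bar>\<alpha>\<bar> * norm (q $ i - centroid q)" for i
  proof -
    have "(stack_const x + \<alpha> *\<^sub>R q) $ i - centroid (stack_const x + \<alpha> *\<^sub>R q) = \<alpha> *\<^sub>R (q $ i - centroid q)"
      unfolding centroid_affine by (simp add: stack_const_def scaleR_diff_right)
    then show ?thesis by simp
  qed
  then show ?thesis
    by (simp add: config_scale_def power_mult_distrib sum_distrib_left[symmetric] real_sqrt_mult
        flip: times_divide_eq_right)
qed

lemma bearing_affine: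
  "\<alpha> \<noteq> 0 \<Longrightarrow> bearing (stack_const x + \<alpha> *\<^sub>R q) i j = sgn \<alpha> *\<^sub>R bearing q i j"
  by (simp add: bearing_def stack_const_def flip: scaleR_diff_right)
     (simp add: sgn_real_def divide_simps)

lemma satisfies_bearings_affine:
  assumes "\<alpha> > 0" "satisfies_bearings E g q"
  shows "satisfies_bearings E g (stack_const x + \<alpha> *\<^sub>R q)"
  using assms bearing_affine[of \<alpha> x q]
  by (auto simp: satisfies_bearings_def collision_free_def stack_const_def)

lemma satisfies_bearings_edge:
  assumes "satisfies_bearings E g p" "(i, j) \<in> E"
  shows "bearing p i j = g i j" "p $ i \<noteq> p $ j"
  using assms by (force simp: satisfies_bearings_def collision_free_def)+

lemma norm_bearing: "p $ i \<noteq> p $ j \<Longrightarrow> norm (bearing p i j) = 1"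
  by (simp add: bearing_def)

text \<open>The target is given by a definite description, so existence and uniqueness are both due.
  A feasible formation is rotated, dilated and translated for existence. For uniqueness, rigidity
  leaves a translation and a factor \<alpha>, equal scales force |\<alpha>| = 1, and \<alpha> = -1
  would reverse the bearings.\<close>

lemma target_configuration_props:
  fixes E :: "('n::finite \<times> 'n) set" and c :: "real^3"
  assumes n: "CARD('n) \<ge> 2" and R: "orthogonal_matrix R"
    and feas: "feasible E g" and rigid: "ensures_inf_bearing_rigidity E g" and s: "s > 0"
  defines "p \<equiv> target_configuration E g R c s"
  shows "centroid p = c" "config_scale p = s" "satisfies_bearings E (\<lambda>i j. R *v g i j) p"
proof -
  let ?h = "\<lambda>i j. R *v g i j"
  let ?P = "\<lambda>p. centroid p = c \<and> config_scale p = s \<and> satisfies_bearings E ?h p"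
  obtain q0 where q0: "satisfies_bearings E g q0" using feas by (auto simp: feasible_def)
  then have q0r: "inf_bearing_rigid E q0" "collision_free E q0"
    using rigid by (auto simp: ensures_inf_bearing_rigidity_def satisfies_bearings_def)
  obtain a b :: 'n where ab: "a \<noteq> b"
    using n by (metis (full_types) card_2_iff' UNIV_I ex_card)
  \<comment> \<open>With no edges the identity would be constant along edges, hence constant,
    against n \<ge> 2. The edge serves to show that the scale of q is nonzero and to exclude
    \<alpha> = -1.\<close>
  obtain i j where ij: "(i, j) \<in> E"
  proof (rule ccontr)
    assume "\<not> thesis"
    then have "E = {}" using that by auto
    then show False using inf_bearing_rigid_connected[OF q0r, of id a b] ab by auto
  qed
  define q where "q = rotate_config R q0"
  have q: "satisfies_bearings E ?h q"
    unfolding q_def by (rule satisfies_bearings_rotate[OF R q0])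
  then have qij: "q $ i \<noteq> q $ j"
    using ij by (auto simp: satisfies_bearings_def collision_free_def)
  have "config_scale q \<noteq> 0"
  proof
    assume "config_scale q = 0"
    then have "\<forall>k. norm (q $ k - centroid q) = 0"
      by (simp add: config_scale_def sum_nonneg_eq_0_iff)
    then show False using qij by simp
  qed
  then have \<sigma>: "config_scale q > 0"
    by (simp add: config_scale_def less_le sum_nonneg)
  let ?\<alpha> = "s / config_scale q"
  let ?p = "stack_const (c - ?\<alpha> *\<^sub>R centroid q) + ?\<alpha> *\<^sub>R q"
  have "?P ?p"
    using \<sigma> s satisfies_bearings_affine[OF _ q, of ?\<alpha>] by (simp add: centroid_affine config_scale_affine)
  moreover have "p2 = p1" if p1: "?P p1" and p2: "?P p2" for p1 p2
  proof -
    have par: "\<exists>l. p2 $ j - p2 $ i = l *\<^sub>R (p1 $ j - p1 $ i)" if e: "(i, j) \<in> E" for i j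
    proof -
      have "bearing p1 i j = bearing p2 i j" "p1 $ i \<noteq> p1 $ j" "p2 $ i \<noteq> p2 $ j"
        using satisfies_bearings_edge[OF _ e] p1 p2 by auto
      then have "p2 $ j - p2 $ i = norm (p2 $ j - p2 $ i) *\<^sub>R ((p1 $ j - p1 $ i) /\<^sub>R norm (p1 $ j - p1 $ i))"
        by (simp add: bearing_def)
      then show ?thesis by (metis scaleR_scaleR)
    qed
    obtain x \<alpha> where x: "p2 = stack_const x + \<alpha> *\<^sub>R p1"
      using rotated_bearings_kernel[OF R rigid _ par] p1 by blast
    then have "\<bar>\<alpha>\<bar> * s = s" using p1 p2 config_scale_affine[of x \<alpha> p1] by simp
    then have \<alpha>: "\<bar>\<alpha>\<bar> = 1" using s by simp
    have "\<alpha> = 1"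
    proof (rule ccontr)
      assume "\<alpha> \<noteq> 1"
      then have "\<alpha> = -1" using \<alpha> by auto
      then have "bearing p2 i j = - bearing p1 i j" using bearing_affine[of \<alpha> x p1 i j] x by simp
      moreover have "bearing p2 i j = bearing p1 i j" "p1 $ i \<noteq> p1 $ j"
        using satisfies_bearings_edge[OF _ ij] p1 p2 by auto
      ultimately have "2 *\<^sub>R bearing p1 i j = 0" "norm (bearing p1 i j) = 1"
        using norm_bearing[of p1 i j] unfolding scaleR_2 by (metis add.right_inverse)+
      then show False by auto
    qed
    moreover from this have "x = 0" using p1 p2 centroid_affine[of x \<alpha> p1] x by simp
    ultimately show ?thesis using x by (simp add: stack_const_def vec_eq_iff)
  qed
  ultimately have "?P (THE p. ?P p)"
    by (intro theI[of ?P ?p]) blast+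
  then show "centroid p = c" "config_scale p = s" "satisfies_bearings E ?h p"
    unfolding p_def target_configuration_def by auto
qed

section \<open>The position dynamics\<close>

text \<open>Cover by copies of the point, of diameter 0. Positive k matters: with
  \<open>0 ^ 0 = 1\<close> the sum would not vanish.\<close>

lemma hausdorff_measure_singleton:
  assumes "k > 0" "N \<subseteq> {x}"
  shows "hausdorff_measure k N = 0"
proof -
  have "(INF U\<in>{U. N \<subseteq> (\<Union>m. U m) \<and> (\<forall>m. bounded (U m) \<and> diameter (U m) \<le> d)}.
          \<Sum>m. ennreal (diameter (U m) ^ k)) \<le> 0" if "d > 0" for d
  proof (rule INF_lower2)
    show "(\<lambda>_. {x}) \<in> {U. N \<subseteq> (\<Union>m::nat. U m) \<and> (\<forall>m. bounded (U m) \<and> diameter (U m) \<le> d)}"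
      using assms that by auto
    show "(\<Sum>m. ennreal (diameter ((\<lambda>_::nat. {x}) m) ^ k)) \<le> 0"
      using assms by (simp add: zero_power)
  qed
  then show ?thesis
    unfolding hausdorff_measure_def by (intro antisym SUP_least) auto
qed

section \<open>Projections orthogonal to a unit vector and their dependence on that vector\<close>

definition perp :: "'a::real_inner \<Rightarrow> 'a \<Rightarrow> 'a" where
  "perp \<beta> v = v - (\<beta> \<bullet> v) *\<^sub>R \<beta>"

lemma perp_diff: "perp \<beta> (v - w) = perp \<beta> v - perp \<beta> w"
  by (simp add: perp_def inner_diff_right scaleR_diff_left)

lemma perp_add: "perp \<beta> (v + w) = perp \<beta> v + perp \<beta> w"
  by (simp add: perp_def inner_add_right scaleR_add_left)

lemma perp_scaleR: "perp \<beta> (c *\<^sub>R v) = c *\<^sub>R perp \<beta> v"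
  by (simp add: perp_def scaleR_diff_right)

lemma perp_self: "norm \<beta> = 1 \<Longrightarrow> perp \<beta> \<beta> = 0"
  by (simp add: perp_def dot_square_norm)

lemma norm_perp_square:
  assumes "norm \<beta> = 1"
  shows "(norm (perp \<beta> v))\<^sup>2 = (norm v)\<^sup>2 - (\<beta> \<bullet> v)\<^sup>2"
proof -
  have "(norm (perp \<beta> v))\<^sup>2 = v \<bullet> v - 2 * (\<beta> \<bullet> v)^2 + (\<beta> \<bullet> v)^2 * (\<beta> \<bullet> \<beta>)"
    unfolding power2_norm_eq_inner perp_def
    by (simp add: inner_diff_left inner_diff_right inner_commute power2_eq_square)
  then show ?thesis using assms by (simp add: dot_square_norm)
qed

lemma norm_perp_le: "norm \<beta> = 1 \<Longrightarrow> norm (perp \<beta> v) \<le> norm v"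
  by (rule power2_le_imp_le) (simp_all add: norm_perp_square)

lemma perp_proj_mult:
  assumes "norm \<beta> = 1"
  shows "perp_proj \<beta> *v v = perp \<beta> v"
proof -
  have "((\<chi> a b. \<beta> $ a * \<beta> $ b) *v v) = (\<beta> \<bullet> v) *\<^sub>R \<beta>"
    by (simp add: vec_eq_iff matrix_vector_mult_def inner_vec_def sum_distrib_left sum_distrib_right mult_ac)
  then show ?thesis
    using assms by (simp add: perp_proj_def perp_def matrix_vector_mult_diff_rdistrib)
qed

lemma norm_sgn_diff_le:
  fixes e e' :: "'a::real_normed_vector"
  assumes "e \<noteq> 0" "e' \<noteq> 0"
  shows "norm (sgn e - sgn e') \<le> 2 * norm (e - e') / norm e"
proof -
  have "norm e *\<^sub>R (sgn e - sgn e') = (e - e') + (norm e' - norm e) *\<^sub>R sgn e'"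
    using assms by (simp add: sgn_div_norm algebra_simps)
  then have "norm e * norm (sgn e - sgn e') = norm ((e - e') + (norm e' - norm e) *\<^sub>R sgn e')"
    by (metis norm_scaleR abs_norm_cancel)
  also have "\<dots> \<le> norm (e - e') + \<bar>norm e' - norm e\<bar>"
    using assms norm_triangle_ineq[of "e - e'" "(norm e' - norm e) *\<^sub>R sgn e'"] by (simp add: norm_sgn)
  also have "\<dots> \<le> 2 * norm (e - e')"
    using norm_triangle_ineq3[of e' e] by (simp add: norm_minus_commute)
  finally show ?thesis using assms by (simp add: field_simps)
qed

text \<open>An exact identity behind two estimates. The first term is expanding where both unit
  vectors have negative inner product with b, and is of second order in the difference of
  directions; the last term is a cross term between lengths and directions.\<close>

lemma inner_perp_diff:
  fixes e e' b :: "'a::real_inner"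
  assumes "e \<noteq> 0" "e' \<noteq> 0"
  shows "(e - e') \<bullet> (perp (sgn e) b - perp (sgn e') b) =
    (norm (sgn e - sgn e'))\<^sup>2 / 2 * (norm e * (- (sgn e' \<bullet> b)) + norm e' * (- (sgn e \<bullet> b)))
      - (norm e - norm e') * ((sgn e - sgn e') \<bullet> b)"
proof -
  obtain \<beta> \<beta>' where b: "\<beta> = sgn e" "\<beta>' = sgn e'" by simp
  have n: "\<beta> \<bullet> \<beta> = 1" "\<beta>' \<bullet> \<beta>' = 1"
    using assms by (simp_all add: b norm_sgn dot_square_norm)
  have e: "e = norm e *\<^sub>R \<beta>" "e' = norm e' *\<^sub>R \<beta>'"
    using assms by (simp_all add: b sgn_div_norm)
  have d: "(norm (\<beta> - \<beta>'))\<^sup>2 / 2 = 1 - \<beta> \<bullet> \<beta>'"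
    unfolding power2_norm_eq_inner using n by (simp add: inner_diff_left inner_diff_right inner_commute)
  obtain a a' where a: "a = norm e" "a' = norm e'" by simp
  have "(a *\<^sub>R \<beta> - a' *\<^sub>R \<beta>') \<bullet> (perp \<beta> b - perp \<beta>' b) =
    (1 - \<beta> \<bullet> \<beta>') * (a * (- (\<beta>' \<bullet> b)) + a' * (- (\<beta> \<bullet> b))) - (a - a') * ((\<beta> - \<beta>') \<bullet> b)"
    using n by (simp add: perp_def inner_diff_left inner_diff_right inner_commute algebra_simps)
  then show ?thesis
    unfolding d[symmetric] a using e unfolding b by simp
qed

text \<open>Away from collisions the unit vectors differ by at most 2d/\<delta> for d the distance
  of e and e'. Inserting this into both terms of \<open>inner_perp_diff\<close> gives the two
  summands of the constant.\<close>

lemma inner_perp_diff_ge_lipschitz: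
  fixes e e' b :: "'a::real_inner"
  assumes \<delta>: "\<delta> > 0" "norm e \<ge> \<delta>" "norm e' \<ge> \<delta>" and M: "norm e \<le> M" "norm e' \<le> M"
    and B: "norm b \<le> B"
  shows "(e - e') \<bullet> (perp (sgn e) b - perp (sgn e') b) \<ge> - (4 * M * B / \<delta>\<^sup>2 + 2 * B / \<delta>) * (norm (e - e'))\<^sup>2"
proof -
  let ?d = "norm (e - e')" and ?s = "norm (sgn e - sgn e')"
  have ne: "e \<noteq> 0" "e' \<noteq> 0" using \<delta> by auto
  have "B \<ge> 0" using B norm_ge_zero order_trans by blast
  have "M \<ge> 0" using M(1) norm_ge_zero order_trans by blast
  have "?s \<le> 2 * ?d / norm e" by (rule norm_sgn_diff_le[OF ne])
  also have "\<dots> \<le> 2 * ?d / \<delta>" using \<delta> ne by (intro divide_left_mono mult_pos_pos) auto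
  finally have s: "?s \<le> 2 * ?d / \<delta>" .
  have abs: "\<bar>sgn x \<bullet> b\<bar> \<le> B" for x :: 'a
  proof -
    have "\<bar>sgn x \<bullet> b\<bar> \<le> norm (sgn x) * norm b" by (rule Cauchy_Schwarz_ineq2)
    also have "\<dots> \<le> 1 * B" by (intro mult_mono) (auto simp: norm_sgn B)
    finally show ?thesis by simp
  qed
  have "norm e * (- (sgn e' \<bullet> b)) \<ge> - (M * B)" "norm e' * (- (sgn e \<bullet> b)) \<ge> - (M * B)"
  proof -
    have "norm x * \<bar>sgn y \<bullet> b\<bar> \<le> M * B" if "norm x \<le> M" for x y :: 'a
      by (intro mult_mono) (use that abs \<open>M \<ge> 0\<close> in auto)
    moreover have "norm x * (- z) \<ge> - (norm x * \<bar>z\<bar>)" for x :: 'a and z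
      by (simp add: mult_left_mono)
    ultimately show "norm e * (- (sgn e' \<bullet> b)) \<ge> - (M * B)" "norm e' * (- (sgn e \<bullet> b)) \<ge> - (M * B)"
      using M by (smt (verit))+
  qed
  then have 1: "?s\<^sup>2 / 2 * (norm e * (- (sgn e' \<bullet> b)) + norm e' * (- (sgn e \<bullet> b))) \<ge> ?s\<^sup>2 / 2 * (- (2 * (M * B)))"
    by (intro mult_left_mono) auto
  have "?s\<^sup>2 \<le> (2 * ?d / \<delta>)\<^sup>2" using s by (intro power_mono) auto
  then have "?s\<^sup>2 * (M * B) \<le> (2 * ?d / \<delta>)\<^sup>2 * (M * B)"
    using \<open>B \<ge> 0\<close> \<open>M \<ge> 0\<close> by (intro mult_right_mono) auto
  also have "\<dots> = 4 * M * B / \<delta>\<^sup>2 * ?d\<^sup>2" by (simp add: power_divide power_mult_distrib)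
  finally have 2: "?s\<^sup>2 / 2 * (- (2 * (M * B))) \<ge> - (4 * M * B / \<delta>\<^sup>2 * ?d\<^sup>2)" by simp
  have "\<bar>(norm e - norm e') * ((sgn e - sgn e') \<bullet> b)\<bar> \<le> ?d * (?s * norm b)"
    unfolding abs_mult by (intro mult_mono norm_triangle_ineq3 Cauchy_Schwarz_ineq2) auto
  also have "\<dots> \<le> ?d * (2 * ?d / \<delta> * B)"
    using s B \<delta> by (intro mult_left_mono mult_mono) auto
  also have "\<dots> = 2 * B / \<delta> * ?d\<^sup>2" by (simp add: power2_eq_square)
  finally have 3: "(norm e - norm e') * ((sgn e - sgn e') \<bullet> b) \<le> 2 * B / \<delta> * ?d\<^sup>2" by simp
  show ?thesis
    unfolding inner_perp_diff[OF ne] using 1 2 3 by (simp add: algebra_simps)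
qed

text \<open>At exact values sgn e = -G and b = 2G the factor - sgn e . b equals 2; with errors at
  most 1/4 it is still at least 1, which produces the expanding term.\<close>

lemma inner_perp_diff_ge_repelling:
  fixes e e' b G :: "'a::real_inner"
  assumes a: "a > 0" "norm e \<ge> a" "norm e' \<ge> a" and G: "norm G = 1"
    and \<eta>: "norm (sgn e + G) \<le> \<eta>" "norm (sgn e' + G) \<le> \<eta>" "norm (b - 2 *\<^sub>R G) \<le> \<eta>" "\<eta> \<le> 1/4"
  shows "(e - e') \<bullet> (perp (sgn e) b - perp (sgn e') b) \<ge>
    a * (norm (sgn e - sgn e'))\<^sup>2 - 3 * \<eta> * norm (e - e') * norm (sgn e - sgn e')"
proof -
  let ?d = "norm (e - e')" and ?s = "norm (sgn e - sgn e')"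
  have ne: "e \<noteq> 0" "e' \<noteq> 0" using a by auto
  have \<kappa>: "- (sgn x \<bullet> b) \<ge> 1" if x: "norm (sgn x + G) \<le> \<eta>" for x
  proof -
    let ?x = "sgn x + G" and ?y = "b - 2 *\<^sub>R G"
    have i: "\<bar>?x \<bullet> G\<bar> \<le> 1/4" "\<bar>G \<bullet> ?y\<bar> \<le> 1/4" "\<bar>?x \<bullet> ?y\<bar> \<le> 1/4"
    proof -
      have "\<bar>?x \<bullet> G\<bar> \<le> norm ?x * norm G" "\<bar>G \<bullet> ?y\<bar> \<le> norm G * norm ?y" by (rule Cauchy_Schwarz_ineq2)+
      then show "\<bar>?x \<bullet> G\<bar> \<le> 1/4" "\<bar>G \<bullet> ?y\<bar> \<le> 1/4" using G x \<eta> by auto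
      have "\<bar>?x \<bullet> ?y\<bar> \<le> norm ?x * norm ?y" by (rule Cauchy_Schwarz_ineq2)
      also have "\<dots> \<le> 1/4 * 1" using x \<eta> by (intro mult_mono) auto
      finally show "\<bar>?x \<bullet> ?y\<bar> \<le> 1/4" by simp
    qed
    have "?x \<bullet> ?y = sgn x \<bullet> b + G \<bullet> b - 2 * (sgn x \<bullet> G) - 2 * (G \<bullet> G)"
      "?x \<bullet> G = sgn x \<bullet> G + G \<bullet> G" "G \<bullet> ?y = G \<bullet> b - 2 * (G \<bullet> G)" "G \<bullet> G = 1"
      using G inner_commute[of G "sgn x"]
      by (simp_all add: inner_add_left inner_diff_right dot_square_norm algebra_simps)
    then show ?thesis using i by linarith
  qed
  have "norm e * (- (sgn e' \<bullet> b)) \<ge> a * 1" "norm e' * (- (sgn e \<bullet> b)) \<ge> a * 1"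
    by (rule mult_mono; use \<kappa> \<eta> a in simp)+
  then have 1: "?s\<^sup>2 / 2 * (norm e * (- (sgn e' \<bullet> b)) + norm e' * (- (sgn e \<bullet> b))) \<ge> ?s\<^sup>2 / 2 * (2 * a)"
    by (intro mult_left_mono) auto
  \<comment> \<open>The chord of two unit vectors is orthogonal to their sum, so this sum may be
    added to b. What remains is made of three vectors of norm at most \<eta>, which makes the cross
    term small.\<close>
  have "(sgn e - sgn e') \<bullet> (sgn e + sgn e') = 0"
    using ne inner_commute[of "sgn e'" "sgn e"]
    by (simp add: inner_diff_left inner_add_right norm_sgn dot_square_norm)
  then have "(sgn e - sgn e') \<bullet> b = (sgn e - sgn e') \<bullet> ((b - 2 *\<^sub>R G) + (sgn e + G) + (sgn e' + G))"
    by (simp add: inner_add_right inner_diff_right)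
  also have "\<bar>\<dots>\<bar> \<le> ?s * norm ((b - 2 *\<^sub>R G) + (sgn e + G) + (sgn e' + G))"
    by (rule Cauchy_Schwarz_ineq2)
  also have "\<dots> \<le> ?s * (3 * \<eta>)"
    using \<eta> by (intro mult_left_mono order_trans[OF norm_triangle_ineq] order_trans[OF add_mono[OF norm_triangle_ineq order_refl]]) auto
  finally have "\<bar>(sgn e - sgn e') \<bullet> b\<bar> \<le> ?s * (3 * \<eta>)" .
  then have "\<bar>(norm e - norm e') * ((sgn e - sgn e') \<bullet> b)\<bar> \<le> ?d * (?s * (3 * \<eta>))"
    unfolding abs_mult by (intro mult_mono norm_triangle_ineq3) auto
  then have "(norm e - norm e') * ((sgn e - sgn e') \<bullet> b) \<le> 3 * \<eta> * ?d * ?s" by (simp add: mult_ac)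
  then show ?thesis
    unfolding inner_perp_diff[OF ne] using 1 by (simp add: mult.commute)
qed

lemma sum_edges: "(\<Sum>i\<in>UNIV. \<Sum>j\<in>neighbors E i. f i j) = (\<Sum>(i::'n::finite, j)\<in>E. f i j)"
proof -
  have "E = Sigma UNIV (neighbors E)" by (auto simp: neighbors_def)
  then show ?thesis by (subst sum.Sigma) auto
qed

lemma bearing_sgn: "bearing p i j = sgn (p $ j - p $ i)"
  by (simp add: bearing_def sgn_div_norm)

text \<open>Summation by parts: the contribution of an edge changes sign when the edge is reversed,
  and E contains both orientations of each edge, hence the factor 1/2.\<close>

lemma inner_position_field:
  assumes sym: "sym E" and g: "bearing_constraints E g" and cf: "collision_free E p"
  shows "y \<bullet> position_field E g Q p =
    (\<Sum>(i, j)\<in>E. (y $ j - y $ i) \<bullet> perp (sgn (p $ j - p $ i)) ((Q $ i + Q $ j) *v g i j)) / 2"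
proof -
  define f where "f i j = perp (sgn (p $ j - p $ i)) ((Q $ i + Q $ j) *v g i j)" for i j
  have ne: "p $ i \<noteq> p $ j" if "(i, j) \<in> E" for i j using cf that by (auto simp: collision_free_def)
  have anti: "f j i = - f i j" if "(i, j) \<in> E" for i j
  proof -
    have "g j i = - g i j" using g that by (force simp: bearing_constraints_def)
    moreover have "sgn (p $ i - p $ j) = - sgn (p $ j - p $ i)"
      by (metis minus_diff_eq sgn_minus)
    ultimately show ?thesis by (simp add: f_def perp_def add.commute linear_neg[OF matrix_vector_mul_linear])
  qed
  have "position_field E g Q p $ i = - (\<Sum>j\<in>neighbors E i. f i j)" for i
    unfolding position_field_def f_def bearing_sgn
    by (auto intro!: sum.cong perp_proj_mult simp: neighbors_def norm_sgn dest: ne)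
  then have 1: "y \<bullet> position_field E g Q p = - (\<Sum>(i, j)\<in>E. y $ i \<bullet> f i j)"
    by (subst inner_vec_def) (simp add: inner_sum_right sum_negf flip: sum_edges)
  have "(\<Sum>(i, j)\<in>E. y $ j \<bullet> f i j) = (\<Sum>(i, j)\<in>E. y $ i \<bullet> f j i)"
    using sum_neighbors_swap[OF sym, of "\<lambda>i j. y $ j \<bullet> f i j"] by (simp add: sum_edges)
  also have "\<dots> = (\<Sum>(i, j)\<in>E. - (y $ i \<bullet> f i j))"
    by (rule sum.cong) (auto simp: anti)
  finally have "(\<Sum>(i, j)\<in>E. y $ j \<bullet> f i j) = - (\<Sum>(i, j)\<in>E. y $ i \<bullet> f i j)"
    by (simp add: sum_negf case_prod_unfold)
  then have "(\<Sum>(i, j)\<in>E. (y $ j - y $ i) \<bullet> f i j) = - 2 * (\<Sum>(i, j)\<in>E. y $ i \<bullet> f i j)"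
    by (simp add: inner_diff_left sum_subtractf case_prod_unfold)
  then show ?thesis using 1 by (simp add: f_def)
qed

lemma finite_uniform_lower_bound:
  fixes f :: "'a \<Rightarrow> 'b \<Rightarrow> real"
  assumes "finite A" "\<And>x. x \<in> A \<Longrightarrow> \<exists>\<delta>>0. \<forall>t\<in>S. \<delta> \<le> f x t"
  shows "\<exists>\<delta>>0. \<forall>x\<in>A. \<forall>t\<in>S. \<delta> \<le> f x t"
  using assms
proof (induction A rule: finite_induct)
  case empty
  show ?case by (intro exI[of _ 1]) simp
next
  case (insert x A)
  obtain \<delta> where "\<delta> > 0" "\<forall>x\<in>A. \<forall>t\<in>S. \<delta> \<le> f x t" using insert by blast
  moreover obtain \<delta>' where "\<delta>' > 0" "\<forall>t\<in>S. \<delta>' \<le> f x t" using insert.prems by blast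
  ultimately show ?case
    by (intro exI[of _ "min \<delta> \<delta>'"]) (auto intro: min.coboundedI1 min.coboundedI2)
qed

section \<open>Scalar differential inequalities\<close>

lemma stays_above_barrier:
  fixes y :: "real \<Rightarrow> real"
  assumes deriv: "\<And>t. t \<ge> 0 \<Longrightarrow> (y has_real_derivative y' t) (at t within {0..})"
    and pos: "\<And>t. t \<ge> t1 \<Longrightarrow> y t = a \<Longrightarrow> y' t > 0"
    and t1: "t1 \<ge> 0" "y t1 \<ge> a" and t: "t \<ge> t1"
  shows "y t \<ge> a"
proof (rule ccontr)
  assume less: "\<not> y t \<ge> a"
  have cont: "continuous_on {t1..t} y"
    by (rule DERIV_continuous_on, rule DERIV_subset[OF deriv]) (use t1 in auto)
  \<comment> \<open>The supremum \<tau> of this set is the last time with y \<ge> a. There y equals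
    a by the intermediate value theorem, and the positive derivative pushes y above a once
    more.\<close>
  define S where "S = {s\<in>{t1..t}. a \<le> y s}"
  have "closed S"
    unfolding S_def using cont by (intro continuous_on_closed_Collect_le) auto
  moreover have "bounded S" by (rule bounded_subset[OF bounded_closed_interval[of t1 t]]) (auto simp: S_def)
  ultimately have "compact S" by (simp add: compact_eq_bounded_closed)
  moreover have "S \<noteq> {}" using t1 t by (auto simp: S_def)
  ultimately obtain \<tau> where \<tau>: "\<tau> \<in> S" "\<And>s. s \<in> S \<Longrightarrow> s \<le> \<tau>"
    using compact_attains_sup by metis
  have \<tau>t: "t1 \<le> \<tau>" "\<tau> < t" "a \<le> y \<tau>" using \<tau> less by (auto simp: S_def order.order_iff_strict)
  have below: "y s < a" if "\<tau> < s" "s \<le> t" for s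
    using \<tau>(2)[of s] that \<tau>t by (force simp: S_def)
  have "y \<tau> = a"
  proof (rule ccontr)
    assume "y \<tau> \<noteq> a"
    then have "a < y \<tau>" using \<tau>t by simp
    moreover have "continuous_on {\<tau>..t} y" by (rule continuous_on_subset[OF cont]) (use \<tau>t in auto)
    ultimately obtain s where "\<tau> \<le> s" "s \<le> t" "y s = a"
      using IVT2'[of y t a \<tau>] less \<tau>t by auto
    then show False using below[of s] \<open>a < y \<tau>\<close> by (cases "s = \<tau>") auto
  qed
  then obtain d where d: "d > 0" "\<And>h. h > 0 \<Longrightarrow> \<tau> + h \<in> {0..} \<Longrightarrow> h < d \<Longrightarrow> y \<tau> < y (\<tau> + h)"
    using has_real_derivative_pos_inc_right[OF deriv[of \<tau>] pos[of \<tau>]] \<tau>t t1 by auto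
  define h where "h = min (d / 2) (t - \<tau>)"
  have "h > 0" "h < d" "\<tau> + h \<le> t" using d \<tau>t by (auto simp: h_def)
  then have "y \<tau> < y (\<tau> + h)" "y (\<tau> + h) < a"
    using d(2)[of h] below[of "\<tau> + h"] \<tau>t t1 by auto
  then show False using \<open>y \<tau> = a\<close> by simp
qed

text \<open>Once \<epsilon> is small, y rises at a definite speed in the band |y| \<le> S - \<eta>,
  so a late visit above its lower edge forces y through it for good. Either such visits recur at
  arbitrarily late times for some \<eta>, or y eventually stays below every level - S +
  \<eta>.\<close>

lemma bistable_limit:
  fixes y :: "real \<Rightarrow> real"
  assumes deriv: "\<And>t. t \<ge> 0 \<Longrightarrow> (y has_real_derivative y' t) (at t within {0..})"
    and lower: "\<And>t. t \<ge> 0 \<Longrightarrow> y' t \<ge> k * (S\<^sup>2 - (y t)\<^sup>2) - \<epsilon> t"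
    and k: "k > 0" and S: "S > 0" and bound: "\<And>t. t \<ge> 0 \<Longrightarrow> \<bar>y t\<bar> \<le> S"
    and \<epsilon>: "(\<epsilon> \<longlongrightarrow> 0) at_top"
  shows "(y \<longlongrightarrow> S) at_top \<or> (y \<longlongrightarrow> - S) at_top"
proof -
  have step: "\<exists>T\<ge>0. \<forall>t1\<ge>T. y t1 \<ge> - S + \<eta> \<longrightarrow> (\<exists>t2. \<forall>t\<ge>t2. y t \<ge> S - \<eta>)"
    if \<eta>: "0 < \<eta>" "\<eta> < S" for \<eta>
  proof -
    \<comment> \<open>Half of the least unperturbed speed in the band; the other half absorbs
      \<epsilon>.\<close>
    define \<gamma> where "\<gamma> = k * (S\<^sup>2 - (S - \<eta>)\<^sup>2) / 2"
    have "(S - \<eta>)\<^sup>2 < S\<^sup>2" using \<eta> by (intro power_strict_mono) auto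
    then have \<gamma>: "\<gamma> > 0" using k by (simp add: \<gamma>_def)
    obtain T where T: "T \<ge> 0" "\<And>t. t \<ge> T \<Longrightarrow> \<epsilon> t < \<gamma>"
    proof -
      have "\<forall>\<^sub>F t in at_top. \<epsilon> t < \<gamma>" using \<epsilon> \<gamma> by (rule order_tendstoD(2))
      then obtain T where "\<And>t. t \<ge> T \<Longrightarrow> \<epsilon> t < \<gamma>" by (auto simp: eventually_at_top_linorder)
      then show ?thesis using that[of "max T 0"] by auto
    qed
    have speed: "y' t > \<gamma>" if "t \<ge> T" "\<bar>y t\<bar> \<le> S - \<eta>" for t
    proof -
      have "\<bar>y t\<bar>\<^sup>2 \<le> (S - \<eta>)\<^sup>2" using that by (intro power_mono) auto
      then have "k * (S\<^sup>2 - (y t)\<^sup>2) \<ge> k * (S\<^sup>2 - (S - \<eta>)\<^sup>2)" using k by (intro mult_left_mono) auto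
      also have "k * (S\<^sup>2 - (S - \<eta>)\<^sup>2) = 2 * \<gamma>" by (simp add: \<gamma>_def)
      finally show ?thesis using lower[of t] T(2)[of t] that T(1) by linarith
    qed
    have barrier: "y t \<ge> a" if "\<bar>a\<bar> \<le> S - \<eta>" "t1 \<ge> T" "y t1 \<ge> a" "t \<ge> t1" for a t t1
    proof (rule stays_above_barrier[OF deriv _ _ \<open>y t1 \<ge> a\<close> \<open>t \<ge> t1\<close>])
      show "y' t > 0" if "t1 \<le> t" "y t = a" for t
        using speed[of t] \<gamma> that \<open>\<bar>a\<bar> \<le> S - \<eta>\<close> \<open>t1 \<ge> T\<close> by simp
    qed (use T that in auto)
    have "\<exists>t2. \<forall>t\<ge>t2. y t \<ge> S - \<eta>" if t1: "t1 \<ge> T" "y t1 \<ge> - S + \<eta>" for t1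
    proof -
      have "\<exists>t2\<ge>t1. y t2 \<ge> S - \<eta>"
      proof (rule ccontr)
        assume no: "\<not> ?thesis"
        have in_band: "\<bar>y t\<bar> \<le> S - \<eta>" if "t \<ge> t1" for t
          using no that barrier[of "- S + \<eta>" t1 t] t1 \<eta> by (force simp: abs_le_iff)
        \<comment> \<open>Long enough for a gain of 2S + 1 at speed \<gamma>, which exceeds the
          total range of y.\<close>
        define t where "t = t1 + (2 * S + 1) / \<gamma>"
        have t: "t1 \<le> t" using \<gamma> S by (simp add: t_def)
        have "y t1 - \<gamma> * t1 \<le> y t - \<gamma> * t"
        proof (rule nondecreasing_if_deriv_nonneg_within[where f = "\<lambda>s. y s - \<gamma> * s" and f' = "\<lambda>s. y' s - \<gamma>"])
          show "((\<lambda>s. y s - \<gamma> * s) has_real_derivative y' s - \<gamma>) (at s within {0..})" if "t1 \<le> s" for s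
            by (rule DERIV_diff[OF deriv]) (use that t1 T in \<open>auto intro!: derivative_eq_intros\<close>)
          show "0 \<le> y' s - \<gamma>" if "t1 < s" for s
            using speed[of s] in_band[of s] that t1 by simp
        qed (use t t1 T in auto)
        moreover have "\<gamma> * t = \<gamma> * t1 + (2 * S + 1)"
        proof -
          have "\<gamma> * ((2 * S + 1) / \<gamma>) = 2 * S + 1"
            using \<gamma> by (metis nonzero_mult_div_cancel_left times_divide_eq_right less_irrefl)
          then show ?thesis by (simp only: t_def distrib_left)
        qed
        ultimately show False using bound[of t] bound[of t1] t t1 T by (simp add: abs_le_iff)
      qed
      then obtain t2 where "t2 \<ge> t1" "y t2 \<ge> S - \<eta>" by blast
      then show ?thesis
        using barrier[of "S - \<eta>" t2] t1 \<eta> by (intro exI[of _ t2]) auto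
    qed
    then show ?thesis using T(1) by blast
  qed
  show ?thesis
  proof (cases "\<exists>\<eta>0. 0 < \<eta>0 \<and> \<eta>0 < S \<and> (\<forall>T. \<exists>t\<ge>T. y t \<ge> - S + \<eta>0)")
    case True
    then obtain \<eta>0 where \<eta>0: "0 < \<eta>0" "\<eta>0 < S" "\<And>T. \<exists>t\<ge>T. y t \<ge> - S + \<eta>0" by blast
    have "(y \<longlongrightarrow> S) at_top"
    proof (rule tendstoI)
      fix e :: real assume e: "e > 0"
      \<comment> \<open>Not larger than \<eta>0, so the late visits above the level - S + \<eta>0
        are also visits above - S + \<eta>.\<close>
      define \<eta> where "\<eta> = min \<eta>0 (e / 2)"
      have \<eta>: "0 < \<eta>" "\<eta> < S" "\<eta> \<le> \<eta>0" "\<eta> < e" using \<eta>0 e by (auto simp: \<eta>_def)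
      obtain T where T: "\<And>t1. t1 \<ge> T \<Longrightarrow> y t1 \<ge> - S + \<eta> \<Longrightarrow> \<exists>t2. \<forall>t\<ge>t2. y t \<ge> S - \<eta>"
        using step[OF \<eta>(1,2)] by blast
      obtain t1 where "t1 \<ge> T" "y t1 \<ge> - S + \<eta>0" using \<eta>0(3) by blast
      then obtain t2 where t2: "\<And>t. t \<ge> t2 \<Longrightarrow> y t \<ge> S - \<eta>" using T[of t1] \<eta> by auto
      have "dist (y t) S < e" if "t \<ge> max t2 0" for t
        using t2[of t] bound[of t] that \<eta> by (simp add: dist_real_def abs_le_iff abs_less_iff)
      then show "\<forall>\<^sub>F t in at_top. dist (y t) S < e"
        by (rule eventually_at_top_linorderI)
    qed
    then show ?thesis ..
  next
    case False
    have "(y \<longlongrightarrow> - S) at_top"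
    proof (rule tendstoI)
      fix e :: real assume e: "e > 0"
      define \<eta> where "\<eta> = min (S / 2) (e / 2)"
      have \<eta>: "0 < \<eta>" "\<eta> < S" "\<eta> < e" using S e by (auto simp: \<eta>_def)
      then obtain T where T: "\<And>t. t \<ge> T \<Longrightarrow> \<not> y t \<ge> - S + \<eta>" using False by blast
      have "dist (y t) (- S) < e" if "t \<ge> max T 0" for t
        using T[of t] bound[of t] that \<eta> by (simp add: dist_real_def abs_le_iff abs_less_iff not_le)
      then show "\<forall>\<^sub>F t in at_top. dist (y t) (- S) < e"
        by (rule eventually_at_top_linorderI)
    qed
    then show ?thesis ..
  qed
qed

section \<open>Position flow driven by converging orientations\<close>

locale bearing_flow =
  fixes E :: "('n::finite \<times> 'n) set" and g :: "'n \<Rightarrow> 'n \<Rightarrow> real^3"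
    and Q :: "real \<Rightarrow> real^3^3^'n" and R :: "real^3^3" and ps :: "real^3^'n"
  assumes sym: "sym E" and g: "bearing_constraints E g"
    and Q: "\<And>t i. t \<ge> 0 \<Longrightarrow> orthogonal_matrix (Q t $ i)"
    and Q_lim: "\<And>i. ((\<lambda>t. Q t $ i) \<longlongrightarrow> R) at_top"
    and R: "orthogonal_matrix R"
    and ps: "satisfies_bearings E (\<lambda>i j. R *v g i j) ps"
    and kernel: "\<And>dq. (\<And>i j. (i, j) \<in> E \<Longrightarrow> \<exists>l. dq $ j - dq $ i = l *\<^sub>R (ps $ j - ps $ i)) \<Longrightarrow>
      \<exists>x \<alpha>. dq = stack_const x + \<alpha> *\<^sub>R ps"
    and nontrivial: "config_scale ps > 0"
begin

definition G :: "'n \<Rightarrow> 'n \<Rightarrow> real^3" where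
  "G i j = R *v g i j"

definition b :: "real \<Rightarrow> 'n \<Rightarrow> 'n \<Rightarrow> real^3" where
  "b t i j = (Q t $ i + Q t $ j) *v g i j"

definition rs :: "real^3^'n" where
  "rs = ps - stack_const (centroid ps)"

text \<open>The centroid of the target is subtracted, not that of p, which keeps differences of
  offsets equal to differences of configurations. That the two centroids agree along solutions is
  \<open>sum_offset\<close>.\<close>

definition offset :: "real^3^'n \<Rightarrow> real^3^'n" where
  "offset p = p - stack_const (centroid ps)"

lemma offset_diff: "offset p $ j - offset p $ i = p $ j - p $ i"
  by (simp add: offset_def stack_const_def)

lemma norm_g: "(i, j) \<in> E \<Longrightarrow> norm (g i j) = 1"
  using g by (auto simp: bearing_constraints_def)

lemma norm_G: "(i, j) \<in> E \<Longrightarrow> norm (G i j) = 1"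
  by (simp add: G_def norm_orthogonal_matrix_mult[OF R] norm_g)

lemma norm_b_le: "t \<ge> 0 \<Longrightarrow> (i, j) \<in> E \<Longrightarrow> norm (b t i j) \<le> 2"
  using norm_triangle_ineq[of "Q t $ i *v g i j" "Q t $ j *v g i j"]
  by (simp add: b_def norm_orthogonal_matrix_mult[OF Q] norm_g matrix_vector_mult_add_rdistrib)

lemma b_lim: "((\<lambda>t. norm (b t i j - 2 *\<^sub>R G i j)) \<longlongrightarrow> 0) at_top"
proof -
  have "bounded_linear (\<lambda>A :: real^3^3. A *v g i j)"
    by (rule linear_conv_bounded_linear[THEN iffD1], rule linearI)
      (simp_all add: matrix_vector_mult_add_rdistrib scaleR_matrix_vector_assoc)
  from bounded_linear.tendsto[OF this tendsto_add[OF Q_lim[of i] Q_lim[of j]]]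
  have "((\<lambda>t. b t i j) \<longlongrightarrow> 2 *\<^sub>R G i j) at_top"
    unfolding b_def G_def scaleR_2 matrix_vector_mult_add_rdistrib[symmetric] .
  then show ?thesis by (simp add: tendsto_norm_zero LIM_zero)
qed

lemma ps_edge:
  assumes "(i, j) \<in> E"
  shows "ps $ j - ps $ i = norm (ps $ j - ps $ i) *\<^sub>R G i j" "norm (ps $ j - ps $ i) > 0"
proof -
  have "bearing ps i j = G i j" and ne: "ps $ i \<noteq> ps $ j"
    using satisfies_bearings_edge[OF ps assms] by (auto simp: G_def)
  then have "G i j = (ps $ j - ps $ i) /\<^sub>R norm (ps $ j - ps $ i)" by (simp only: bearing_def)
  then show "ps $ j - ps $ i = norm (ps $ j - ps $ i) *\<^sub>R G i j" using ne by (simp only: scaleR_scaleR) simp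
  show "norm (ps $ j - ps $ i) > 0" using ne by simp
qed

lemma rs_diff: "rs $ j - rs $ i = ps $ j - ps $ i"
  by (simp add: rs_def stack_const_def)

lemma sum_rs: "(\<Sum>i\<in>UNIV. rs $ i) = 0"
  by (simp add: rs_def stack_const_def centroid_def sum_subtractf sum_constant_scaleR del: sum_constant)

lemma rs_nonzero: "norm rs > 0"
proof -
  have "rs \<noteq> 0"
  proof
    assume "rs = 0"
    then have "ps $ i = centroid ps" for i
      by (auto simp: rs_def stack_const_def vec_eq_iff)
    then show False using nontrivial by (simp add: config_scale_def)
  qed
  then show ?thesis by simp
qed

text \<open>Quantitative rigidity: among displacements with vanishing sum and orthogonal to
  \<open>rs\<close>, only 0 is parallel to all target edges. An injective linear map on a
  finite-dimensional space is bounded below.\<close>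

lemma kernel_bound:
  "\<exists>\<mu>>0. \<forall>v. (\<Sum>i\<in>UNIV. v $ i) = 0 \<longrightarrow>
    \<mu> * norm (v - ((v \<bullet> rs) / (norm rs)\<^sup>2) *\<^sub>R rs) \<le> (\<Sum>(i, j)\<in>E. norm (perp (G i j) (v $ j - v $ i)))"
proof -
  define f :: "real^3^'n \<Rightarrow> real^3^('n \<times> 'n)" where
    "f v = (\<chi> e. if e \<in> E then perp (G (fst e) (snd e)) (v $ snd e - v $ fst e) else 0)" for v
  have f: "bounded_linear f"
  proof (rule linear_conv_bounded_linear[THEN iffD1], rule linearI)
    show "f (v + w) = f v + f w" for v w
      by (simp add: f_def vec_eq_iff perp_add add_diff_add)
    show "f (c *\<^sub>R v) = c *\<^sub>R f v" for c v
      by (simp add: f_def vec_eq_iff perp_scaleR flip: scaleR_diff_right)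
  qed
  define V where "V = {v :: real^3^'n. (\<Sum>i\<in>UNIV. v $ i) = 0 \<and> v \<bullet> rs = 0}"
  have V: "subspace V"
    by (auto simp: subspace_def V_def sum.distrib inner_add_left simp flip: scaleR_right.sum)
  have inj: "\<forall>v\<in>V. f v = 0 \<longrightarrow> v = 0"
  proof (intro ballI impI)
    fix v assume v: "v \<in> V" "f v = 0"
    have "\<exists>l. v $ j - v $ i = l *\<^sub>R (ps $ j - ps $ i)" if e: "(i, j) \<in> E" for i j
    proof -
      have "f v $ (i, j) = 0" using v by simp
      then have "v $ j - v $ i = (G i j \<bullet> (v $ j - v $ i)) *\<^sub>R G i j"
        using e by (simp add: f_def perp_def)
      also have "G i j = inverse (norm (ps $ j - ps $ i)) *\<^sub>R (ps $ j - ps $ i)"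
        using ps_edge(2)[OF e] by (subst ps_edge(1)[OF e]) simp
      finally show ?thesis unfolding scaleR_scaleR by blast
    qed
    then obtain x \<alpha> where x: "v = stack_const x + \<alpha> *\<^sub>R ps" using kernel by blast
    define z where "z = x + \<alpha> *\<^sub>R centroid ps"
    have vz: "v = stack_const z + \<alpha> *\<^sub>R rs"
      by (simp add: x z_def rs_def stack_const_def vec_eq_iff scaleR_diff_right)
    have "(\<Sum>i\<in>UNIV. v $ i) = real CARD('n) *\<^sub>R z + \<alpha> *\<^sub>R (\<Sum>i\<in>UNIV. rs $ i)"
      by (simp add: vz stack_const_def sum.distrib scaleR_right.sum sum_constant_scaleR del: sum_constant)
    then have "z = 0" using v sum_rs by (simp add: V_def)
    then have v': "v = \<alpha> *\<^sub>R rs" using vz by (simp add: stack_const_def vec_eq_iff)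
    then have "\<alpha> * (rs \<bullet> rs) = 0" using v by (simp add: V_def)
    then show "v = 0" using v' rs_nonzero by auto
  qed
  obtain \<mu> where \<mu>: "\<mu> > 0" "\<And>v. v \<in> V \<Longrightarrow> norm (f v) \<ge> \<mu> * norm v"
    using injective_imp_isometric[OF closed_subspace[OF V] V f inj] by blast
  have "\<mu> * norm (v - ((v \<bullet> rs) / (norm rs)\<^sup>2) *\<^sub>R rs) \<le> (\<Sum>(i, j)\<in>E. norm (perp (G i j) (v $ j - v $ i)))"
    if v: "(\<Sum>i\<in>UNIV. v $ i) = 0" for v
  proof -
    let ?c = "(v \<bullet> rs) / (norm rs)\<^sup>2"
    let ?w = "v - ?c *\<^sub>R rs"
    have "?w \<in> V"
      using v sum_rs rs_nonzero
      by (simp add: V_def sum_subtractf inner_diff_left dot_square_norm flip: scaleR_right.sum)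
    then have "\<mu> * norm ?w \<le> norm (f ?w)" by (rule \<mu>(2))
    \<comment> \<open>The edges of \<open>rs\<close> are multiples of the bearings G, so f does not
      see the component along \<open>rs\<close>.\<close>
    also have "f ?w = f v"
    proof -
      have "perp (G i j) (?w $ j - ?w $ i) = perp (G i j) (v $ j - v $ i)" if e: "(i, j) \<in> E" for i j
      proof -
        have "?w $ j - ?w $ i = (v $ j - v $ i) - ?c *\<^sub>R (rs $ j - rs $ i)"
          by (simp add: scaleR_diff_right)
        also have "\<dots> = (v $ j - v $ i) - (?c * norm (ps $ j - ps $ i)) *\<^sub>R G i j"
          unfolding rs_diff by (subst ps_edge(1)[OF e]) simp
        finally show ?thesis
          by (simp only: perp_diff perp_scaleR perp_self[OF norm_G[OF e]]) simp
      qed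
      then show ?thesis by (auto simp: f_def vec_eq_iff)
    qed
    also have "norm (f v) \<le> (\<Sum>e\<in>UNIV. norm (f v $ e))"
      unfolding norm_vec_def by (rule L2_set_le_sum) auto
    also have "\<dots> = (\<Sum>e\<in>E. norm (perp (G (fst e) (snd e)) (v $ snd e - v $ fst e)))"
      unfolding f_def by (simp add: if_distrib sum.If_cases cong: if_cong)
    finally show ?thesis by (simp add: case_prod_unfold)
  qed
  then show ?thesis using \<mu>(1) by blast
qed

end

lemma inner_perp_sgn: "e \<bullet> perp (sgn e) v = 0"
proof (cases "e = 0")
  case False
  then have "sgn e \<bullet> perp (sgn e) v = 0"
    by (simp add: perp_def inner_diff_right norm_sgn dot_square_norm)
  then have "(norm e *\<^sub>R sgn e) \<bullet> perp (sgn e) v = 0" by simp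
  then show ?thesis using False by (simp add: sgn_div_norm)
qed simp

lemma constant_if_deriv_zero_within:
  fixes f :: "real \<Rightarrow> real"
  assumes deriv: "\<And>t. t \<ge> 0 \<Longrightarrow> (f has_real_derivative 0) (at t within {0..})" and t: "t \<ge> 0"
  shows "f t = f 0"
proof -
  have "f 0 \<le> f t"
    by (rule nondecreasing_if_deriv_nonneg_within[where f' = "\<lambda>_. 0"]) (use deriv t in auto)
  moreover have "- f 0 \<le> - f t"
  proof (rule nondecreasing_if_deriv_nonneg_within[where f = "\<lambda>t. - f t" and f' = "\<lambda>_. 0"])
    show "((\<lambda>t. - f t) has_real_derivative 0) (at t within {0..})" if "0 \<le> t" for t
      using DERIV_minus[OF deriv[OF that]] by simp
  qed (use t in auto)
  ultimately show ?thesis by simp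
qed

lemma norm_component_diff_le: "norm ((v :: 'a::real_normed_vector^'n) $ j - v $ i) \<le> 2 * norm v"
proof -
  have "norm (v $ k) \<le> norm v" for k by (rule Finite_Cartesian_Product.norm_nth_le)
  then show ?thesis using norm_triangle_ineq4[of "v $ j" "v $ i"] by (smt (verit))
qed

section \<open>Conserved quantities, the two possible limits, and repulsion from the opposite
  one\<close>

context bearing_flow
begin

text \<open>The conditions on sphere and centroid are imposed at time 0 only;
  \<open>norm_offset\<close> and \<open>sum_offset\<close> propagate them.\<close>

definition trajectory :: "(real \<Rightarrow> real^3^'n) \<Rightarrow> bool" where
  "trajectory p \<longleftrightarrow> position_solution E g Q p \<and> norm (offset (p 0)) = norm rs \<and>
     (\<Sum>i\<in>UNIV. offset (p 0) $ i) = 0"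

lemma trajectory_edge_nonzero:
  "trajectory p \<Longrightarrow> t \<ge> 0 \<Longrightarrow> (i, j) \<in> E \<Longrightarrow> p t $ j - p t $ i \<noteq> 0"
  by (force simp: trajectory_def position_solution_def collision_free_def)

lemma inner_field:
  assumes "trajectory p" "t \<ge> 0"
  shows "y \<bullet> position_field E g (Q t) (p t) =
    (\<Sum>(i, j)\<in>E. (y $ j - y $ i) \<bullet> perp (sgn (p t $ j - p t $ i)) (b t i j)) / 2"
  unfolding b_def
  by (rule inner_position_field[OF sym g]) (use assms in \<open>auto simp: trajectory_def position_solution_def\<close>)

lemma offset_deriv:
  assumes "trajectory p" "t \<ge> 0"
  shows "((\<lambda>t. offset (p t)) has_vector_derivative position_field E g (Q t) (p t)) (at t within {0..})"
  using assms unfolding offset_def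
  by (auto simp: trajectory_def position_solution_def intro: has_vector_derivative_diff[OF _ has_vector_derivative_const, simplified])

lemma inner_offset_deriv:
  assumes "trajectory p" "t \<ge> 0"
  shows "((\<lambda>t. y \<bullet> offset (p t)) has_real_derivative
    (\<Sum>(i, j)\<in>E. (y $ j - y $ i) \<bullet> perp (sgn (p t $ j - p t $ i)) (b t i j)) / 2) (at t within {0..})"
  using bounded_linear.has_vector_derivative[OF bounded_linear_inner_right offset_deriv[OF assms], of y]
  unfolding inner_field[OF assms] has_real_derivative_iff_has_vector_derivative .

lemma sum_offset:
  assumes p: "trajectory p" and t: "t \<ge> 0"
  shows "(\<Sum>i\<in>UNIV. offset (p t) $ i) = 0"
proof -
  let ?x = "\<Sum>i\<in>UNIV. offset (p t) $ i"
  have e: "stack_const x \<bullet> v = x \<bullet> (\<Sum>i\<in>UNIV. v $ i)" for x and v :: "real^3^'n"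
    by (subst inner_vec_def) (simp add: stack_const_def inner_sum_right)
  \<comment> \<open>A constant stacked vector has no edge differences, so its inner product with the
    offset is conserved. Here ?x is frozen as the sum at the given time, which turns conservation
    into \<open>?x \<bullet> ?x = 0\<close>.\<close>
  have "stack_const ?x \<bullet> offset (p t) = stack_const ?x \<bullet> offset (p 0)"
  proof (rule constant_if_deriv_zero_within[OF _ t, where f = "\<lambda>t. stack_const ?x \<bullet> offset (p t)"])
    show "((\<lambda>t. stack_const ?x \<bullet> offset (p t)) has_real_derivative 0) (at t within {0..})" if "t \<ge> 0" for t
      using inner_offset_deriv[OF p that, of "stack_const ?x"] by (simp add: stack_const_def case_prod_unfold)
  qed
  then have "?x \<bullet> ?x = 0" unfolding e using p by (simp add: trajectory_def)
  then show ?thesis by simp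
qed

text \<open>The contribution of each edge is perpendicular to that edge, so the field is orthogonal
  to the offset.\<close>

lemma norm_offset:
  assumes p: "trajectory p" and t: "t \<ge> 0"
  shows "norm (offset (p t)) = norm rs"
proof -
  have "offset (p t) \<bullet> offset (p t) = offset (p 0) \<bullet> offset (p 0)"
  proof (rule constant_if_deriv_zero_within[OF _ t, where f = "\<lambda>t. offset (p t) \<bullet> offset (p t)"])
    show "((\<lambda>t. offset (p t) \<bullet> offset (p t)) has_real_derivative 0) (at t within {0..})" if t: "t \<ge> 0" for t
    proof -
      have "offset (p t) \<bullet> position_field E g (Q t) (p t) = 0"
        unfolding inner_field[OF p t] offset_diff by (simp add: inner_perp_sgn case_prod_unfold)
      then show ?thesis
        using bounded_bilinear.has_vector_derivative[OF bounded_bilinear_inner offset_deriv[OF p t] offset_deriv[OF p t]]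
        by (simp add: inner_commute has_real_derivative_iff_has_vector_derivative)
    qed
  qed
  then have "norm (offset (p t)) = norm (offset (p 0))" by (simp add: norm_eq_sqrt_inner)
  then show ?thesis using p by (simp add: trajectory_def)
qed

lemma norm_edge_le:
  assumes "norm (offset p) = norm rs"
  shows "norm (p $ j - p $ i) \<le> 2 * norm rs"
  using norm_component_diff_le[of "offset p" j i] assms by (simp add: offset_diff)

lemma edge_length_bound: "\<exists>a>0. \<forall>(i, j)\<in>E. a \<le> norm (ps $ j - ps $ i)"
proof -
  \<comment> \<open>A one-point time set lets the uniform bound for curves cover a fixed
    configuration.\<close>
  have "\<exists>a>0. \<forall>e\<in>E. \<forall>_\<in>{()}. a \<le> norm (ps $ snd e - ps $ fst e)"
  proof (rule finite_uniform_lower_bound)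
    fix e assume "e \<in> E"
    then have "norm (ps $ snd e - ps $ fst e) > 0" using ps_edge(2)[of "fst e" "snd e"] by simp
    then show "\<exists>\<delta>>0. \<forall>_\<in>{()}. \<delta> \<le> norm (ps $ snd e - ps $ fst e)" by blast
  qed simp
  then show ?thesis by (simp add: case_prod_unfold)
qed

lemma limit_dichotomy:
  assumes p: "trajectory p"
  shows "((\<lambda>t. offset (p t)) \<longlongrightarrow> rs) at_top \<or> ((\<lambda>t. offset (p t)) \<longlongrightarrow> - rs) at_top"
proof -
  let ?\<rho> = "norm rs"
  note \<rho> = rs_nonzero
  define y where "y t = rs \<bullet> offset (p t)" for t
  define y' where "y' t = (\<Sum>(i, j)\<in>E. (rs $ j - rs $ i) \<bullet> perp (sgn (p t $ j - p t $ i)) (b t i j)) / 2" for t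
  define \<epsilon> where "\<epsilon> t = (\<Sum>(i, j)\<in>E. norm (ps $ j - ps $ i) * norm (b t i j - 2 *\<^sub>R G i j)) / 2" for t
  obtain a where a: "a > 0" "\<And>i j. (i, j) \<in> E \<Longrightarrow> a \<le> norm (ps $ j - ps $ i)"
    using edge_length_bound by blast
  obtain \<mu> where \<mu>: "\<mu> > 0" "\<And>v. (\<Sum>i\<in>UNIV. v $ i) = 0 \<Longrightarrow>
    \<mu> * norm (v - ((v \<bullet> rs) / ?\<rho>\<^sup>2) *\<^sub>R rs) \<le> (\<Sum>(i, j)\<in>E. norm (perp (G i j) (v $ j - v $ i)))"
    using kernel_bound by blast
  define m where "m = real (card E) + 1"
  have m: "m > 0" by (simp add: m_def)
  \<comment> \<open>The factor \<open>a / (4 * \<rho>\<^sup>2)\<close>, with \<rho> the norm of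
    \<open>rs\<close>, is half the edge estimate below. Coercivity and Cauchy-Schwarz over the edges
    give \<open>\<mu>\<^sup>2 / m\<close>. The last \<open>\<rho>\<^sup>2\<close> comes from
    expressing the part of the offset orthogonal to \<open>rs\<close> through y.\<close>
  define k where "k = a * \<mu>\<^sup>2 / (4 * ?\<rho>\<^sup>2 * m * ?\<rho>\<^sup>2)"
  \<comment> \<open>With b = 2G + z, the main part of G . perp \<beta> b is twice the squared sine
    of the angle between edge and target bearing. As edges have length at most twice the norm of
    \<open>rs\<close>, this squared sine is bounded below by the squared part of the edge transverse
    to G.\<close>
  have edge: "(rs $ j - rs $ i) \<bullet> perp (sgn (p t $ j - p t $ i)) (b t i j) \<ge>
      a / (2 * ?\<rho>\<^sup>2) * (norm (perp (G i j) (p t $ j - p t $ i)))\<^sup>2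
        - norm (ps $ j - ps $ i) * norm (b t i j - 2 *\<^sub>R G i j)"
    if t: "t \<ge> 0" and ij: "(i, j) \<in> E" for t i j
  proof -
    let ?e = "p t $ j - p t $ i" and ?G = "G i j" and ?l = "norm (ps $ j - ps $ i)"
    let ?\<beta> = "sgn ?e" and ?z = "b t i j - 2 *\<^sub>R G i j"
    have e: "?e \<noteq> 0" by (rule trajectory_edge_nonzero[OF p t ij])
    then have \<beta>: "norm ?\<beta> = 1" by (simp add: norm_sgn)
    have GG: "?G \<bullet> ?G = 1" using norm_G[OF ij] by (simp add: dot_square_norm)
    have "perp ?\<beta> (b t i j) = 2 *\<^sub>R perp ?\<beta> ?G + perp ?\<beta> ?z"
      by (simp add: perp_diff perp_scaleR)
    then have "?G \<bullet> perp ?\<beta> (b t i j) = 2 - 2 * (?\<beta> \<bullet> ?G)\<^sup>2 + ?G \<bullet> perp ?\<beta> ?z"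
      using GG by (simp add: inner_add_right perp_def[of ?\<beta> ?G] inner_diff_right power2_eq_square inner_commute)
    moreover have "\<bar>?G \<bullet> perp ?\<beta> ?z\<bar> \<le> norm ?z"
    proof -
      have "\<bar>?G \<bullet> perp ?\<beta> ?z\<bar> \<le> norm ?G * norm (perp ?\<beta> ?z)" by (rule Cauchy_Schwarz_ineq2)
      then show ?thesis using norm_G[OF ij] norm_perp_le[OF \<beta>, of ?z] by simp
    qed
    moreover have "(norm (perp ?G ?e))\<^sup>2 / (4 * ?\<rho>\<^sup>2) \<le> 1 - (?\<beta> \<bullet> ?G)\<^sup>2"
    proof -
      have "norm ?e *\<^sub>R ?\<beta> = ?e" using e by (simp add: sgn_div_norm)
      moreover have "?G \<bullet> (norm ?e *\<^sub>R ?\<beta>) = norm ?e * (?\<beta> \<bullet> ?G)"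
        by (simp only: inner_scaleR_right inner_commute[of ?G])
      ultimately have "?G \<bullet> ?e = norm ?e * (?\<beta> \<bullet> ?G)" by (simp only:)
      then have n: "(norm (perp ?G ?e))\<^sup>2 = (norm ?e)\<^sup>2 * (1 - (?\<beta> \<bullet> ?G)\<^sup>2)"
        by (simp add: norm_perp_square[OF norm_G[OF ij]] power_mult_distrib right_diff_distrib)
      have "\<bar>?\<beta> \<bullet> ?G\<bar> \<le> 1"
        using Cauchy_Schwarz_ineq2[of ?\<beta> ?G] \<beta> norm_G[OF ij] by simp
      then have "(?\<beta> \<bullet> ?G)\<^sup>2 \<le> 1" by (simp add: abs_square_le_1)
      moreover have "(norm ?e)\<^sup>2 \<le> (2 * ?\<rho>)\<^sup>2"
        using norm_edge_le[OF norm_offset[OF p t]] by (intro power_mono) auto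
      ultimately have "(norm (perp ?G ?e))\<^sup>2 \<le> (2 * ?\<rho>)\<^sup>2 * (1 - (?\<beta> \<bullet> ?G)\<^sup>2)"
        unfolding n by (intro mult_right_mono) auto
      then show ?thesis using \<rho> by (simp add: divide_le_eq power_mult_distrib mult.commute)
    qed
    ultimately have "?G \<bullet> perp ?\<beta> (b t i j) \<ge> 2 * ((norm (perp ?G ?e))\<^sup>2 / (4 * ?\<rho>\<^sup>2)) - norm ?z"
      by linarith
    then have "?l * (?G \<bullet> perp ?\<beta> (b t i j)) \<ge> ?l * ((norm (perp ?G ?e))\<^sup>2 / (2 * ?\<rho>\<^sup>2) - norm ?z)"
      by (intro mult_left_mono) auto
    moreover have "?l * ((norm (perp ?G ?e))\<^sup>2 / (2 * ?\<rho>\<^sup>2)) \<ge> a * ((norm (perp ?G ?e))\<^sup>2 / (2 * ?\<rho>\<^sup>2))"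
      using a(2)[OF ij] by (intro mult_right_mono) auto
    moreover have "(rs $ j - rs $ i) \<bullet> perp ?\<beta> (b t i j) = ?l * (?G \<bullet> perp ?\<beta> (b t i j))"
      unfolding rs_diff by (subst ps_edge(1)[OF ij]) simp
    ultimately show ?thesis by (simp add: right_diff_distrib)
  qed
  have "(y \<longlongrightarrow> ?\<rho>\<^sup>2) at_top \<or> (y \<longlongrightarrow> - ?\<rho>\<^sup>2) at_top"
  proof (rule bistable_limit[where y' = y' and k = k and \<epsilon> = \<epsilon>])
    show "(y has_real_derivative y' t) (at t within {0..})" if "t \<ge> 0" for t
      using inner_offset_deriv[OF p that, of rs] by (simp add: y_def[abs_def] y'_def)
    show "k > 0" using a \<mu> \<rho> m by (simp add: k_def)
    show "?\<rho>\<^sup>2 > 0" using \<rho> by simp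
    show "\<bar>y t\<bar> \<le> ?\<rho>\<^sup>2" if "t \<ge> 0" for t
      using Cauchy_Schwarz_ineq2[of rs "offset (p t)"] norm_offset[OF p that]
      by (simp add: y_def power2_eq_square)
    have "(\<epsilon> \<longlongrightarrow> (\<Sum>(i, j)\<in>E. norm (ps $ j - ps $ i) * 0) / 2) at_top"
      unfolding \<epsilon>_def case_prod_unfold by (intro tendsto_intros b_lim) simp
    then show "(\<epsilon> \<longlongrightarrow> 0) at_top" by (simp add: case_prod_unfold)
    show "y' t \<ge> k * ((?\<rho>\<^sup>2)\<^sup>2 - (y t)\<^sup>2) - \<epsilon> t" if t: "t \<ge> 0" for t
    proof -
      let ?o = "offset (p t)"
      let ?f = "\<lambda>i j. norm (perp (G i j) (?o $ j - ?o $ i))"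
      let ?w = "?o - ((?o \<bullet> rs) / ?\<rho>\<^sup>2) *\<^sub>R rs"
      have "\<mu> * norm ?w \<le> (\<Sum>(i, j)\<in>E. ?f i j)"
        by (rule \<mu>(2)) (rule sum_offset[OF p t])
      then have "(\<mu> * norm ?w)\<^sup>2 \<le> (\<Sum>(i, j)\<in>E. ?f i j)\<^sup>2"
        using \<mu>(1) by (intro power_mono) auto
      also have "\<dots> \<le> (\<Sum>(i, j)\<in>E. (?f i j)\<^sup>2) * real (card E)"
        using sum_squared_le_sum_of_squares[of "\<lambda>(i, j). ?f i j" E] by (simp add: case_prod_unfold)
      also have "\<dots> \<le> (\<Sum>(i, j)\<in>E. (?f i j)\<^sup>2) * m"
        by (intro mult_left_mono sum_nonneg) (auto simp: m_def)
      finally have 1: "\<mu>\<^sup>2 * (norm ?w)\<^sup>2 / m \<le> (\<Sum>(i, j)\<in>E. (?f i j)\<^sup>2)"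
        using m by (simp add: divide_le_eq power_mult_distrib)
      let ?c = "(?o \<bullet> rs) / ?\<rho>\<^sup>2"
      have "(?o - d *\<^sub>R rs) \<bullet> (?o - d *\<^sub>R rs) = ?o \<bullet> ?o - 2 * d * (?o \<bullet> rs) + d\<^sup>2 * (rs \<bullet> rs)" for d
        by (simp only: inner_diff_left inner_diff_right inner_scaleR_left inner_scaleR_right)
          (simp add: inner_commute[of rs ?o] power2_eq_square algebra_simps)
      then have "?w \<bullet> ?w = ?o \<bullet> ?o - 2 * ?c * (?o \<bullet> rs) + ?c\<^sup>2 * (rs \<bullet> rs)" .
      also have "\<dots> = ?o \<bullet> ?o - (?o \<bullet> rs)\<^sup>2 / ?\<rho>\<^sup>2"
        using \<rho> unfolding dot_square_norm[of rs] by (simp add: field_simps power2_eq_square)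
      finally have "(norm ?w)\<^sup>2 = ?o \<bullet> ?o - (?o \<bullet> rs)\<^sup>2 / ?\<rho>\<^sup>2"
        by (simp only: power2_norm_eq_inner)
      then have w: "(norm ?w)\<^sup>2 = ((?\<rho>\<^sup>2)\<^sup>2 - (y t)\<^sup>2) / ?\<rho>\<^sup>2"
        using norm_offset[OF p t] \<rho> by (simp add: y_def inner_commute dot_square_norm diff_divide_distrib power2_eq_square)
      have "k * ((?\<rho>\<^sup>2)\<^sup>2 - (y t)\<^sup>2) = a / (4 * ?\<rho>\<^sup>2) * (\<mu>\<^sup>2 * (norm ?w)\<^sup>2 / m)"
        unfolding w k_def by (simp add: mult_ac)
      also have "\<dots> \<le> a / (4 * ?\<rho>\<^sup>2) * (\<Sum>(i, j)\<in>E. (?f i j)\<^sup>2)"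
        by (rule mult_left_mono[OF 1]) (use a in auto)
      also have "\<dots> = (\<Sum>(i, j)\<in>E. a / (2 * ?\<rho>\<^sup>2) * (?f i j)\<^sup>2) / 2"
        by (simp add: sum_distrib_left case_prod_unfold flip: sum_divide_distrib)
      finally have "k * ((?\<rho>\<^sup>2)\<^sup>2 - (y t)\<^sup>2) - \<epsilon> t \<le>
        (\<Sum>(i, j)\<in>E. a / (2 * ?\<rho>\<^sup>2) * (?f i j)\<^sup>2 - norm (ps $ j - ps $ i) * norm (b t i j - 2 *\<^sub>R G i j)) / 2"
        by (simp add: \<epsilon>_def sum_subtractf case_prod_unfold diff_divide_distrib)
      also have "\<dots> \<le> y' t"
        unfolding y'_def offset_diff
        by (intro divide_right_mono sum_mono) (use edge[OF t] in auto)
      finally show ?thesis .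
    qed
  qed
  then show ?thesis
  proof
    assume y: "(y \<longlongrightarrow> ?\<rho>\<^sup>2) at_top"
    have "((\<lambda>t. sqrt (2 * ?\<rho>\<^sup>2 - 2 * y t)) \<longlongrightarrow> sqrt (2 * ?\<rho>\<^sup>2 - 2 * ?\<rho>\<^sup>2)) at_top"
      by (intro tendsto_intros y)
    moreover have "\<forall>\<^sub>F t in at_top. sqrt (2 * ?\<rho>\<^sup>2 - 2 * y t) = norm (offset (p t) - rs)"
      using eventually_ge_at_top[of 0]
    proof eventually_elim
      case (elim t)
      show ?case
      proof (rule real_sqrt_unique)
        show "(norm (offset (p t) - rs))\<^sup>2 = 2 * ?\<rho>\<^sup>2 - 2 * y t"
          using dot_norm_neg[of "offset (p t)" rs] norm_offset[OF p elim] inner_commute[of rs "offset (p t)"]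
          by (simp add: y_def)
      qed simp
    qed
    ultimately have "((\<lambda>t. norm (offset (p t) - rs)) \<longlongrightarrow> sqrt (2 * ?\<rho>\<^sup>2 - 2 * ?\<rho>\<^sup>2)) at_top"
      by (rule Lim_transform_eventually)
    then have "((\<lambda>t. norm (offset (p t) - rs)) \<longlongrightarrow> 0) at_top" by simp
    then have "((\<lambda>t. offset (p t) - rs) \<longlongrightarrow> 0) at_top" by (rule tendsto_norm_zero_cancel)
    then have "((\<lambda>t. offset (p t)) \<longlongrightarrow> rs) at_top" by (rule LIM_zero_cancel)
    then show ?thesis ..
  next
    assume y: "(y \<longlongrightarrow> - ?\<rho>\<^sup>2) at_top"
    have "((\<lambda>t. sqrt (2 * ?\<rho>\<^sup>2 + 2 * y t)) \<longlongrightarrow> sqrt (2 * ?\<rho>\<^sup>2 + 2 * (- ?\<rho>\<^sup>2))) at_top"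
      by (intro tendsto_intros y)
    moreover have "\<forall>\<^sub>F t in at_top. sqrt (2 * ?\<rho>\<^sup>2 + 2 * y t) = norm (offset (p t) - (- rs))"
      using eventually_ge_at_top[of 0]
    proof eventually_elim
      case (elim t)
      show ?case
      proof (rule real_sqrt_unique)
        show "(norm (offset (p t) - (- rs)))\<^sup>2 = 2 * ?\<rho>\<^sup>2 + 2 * y t"
          using dot_norm[of "offset (p t)" rs] norm_offset[OF p elim] inner_commute[of rs "offset (p t)"]
          by (simp add: y_def)
      qed simp
    qed
    ultimately have "((\<lambda>t. norm (offset (p t) - (- rs))) \<longlongrightarrow> sqrt (2 * ?\<rho>\<^sup>2 + 2 * (- ?\<rho>\<^sup>2))) at_top"
      by (rule Lim_transform_eventually)
    then have "((\<lambda>t. norm (offset (p t) - (- rs))) \<longlongrightarrow> 0) at_top" by simp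
    then have "((\<lambda>t. offset (p t) - (- rs)) \<longlongrightarrow> 0) at_top" by (rule tendsto_norm_zero_cancel)
    then have "((\<lambda>t. offset (p t)) \<longlongrightarrow> - rs) at_top" by (rule LIM_zero_cancel)
    then show ?thesis ..
  qed
qed

text \<open>The field is expanding along the sphere near the configuration opposite to the target.\<close>

lemma repelling_sum_nonneg:
  fixes p p' :: "real^3^'n" and v :: "'n \<Rightarrow> 'n \<Rightarrow> real^3"
  defines "m \<equiv> real (card E) + 1"
  assumes kb: "\<And>v. (\<Sum>i\<in>UNIV. v $ i) = 0 \<Longrightarrow>
    \<mu> * norm (v - ((v \<bullet> rs) / (norm rs)\<^sup>2) *\<^sub>R rs) \<le> (\<Sum>(i, j)\<in>E. norm (perp (G i j) (v $ j - v $ i)))"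
    and \<mu>: "\<mu> > 0" and a: "a > 0"
    and n: "norm (offset p) = norm rs" "norm (offset p') = norm rs"
    and z: "(\<Sum>i\<in>UNIV. offset p $ i) = 0" "(\<Sum>i\<in>UNIV. offset p' $ i) = 0"
    and \<eta>: "0 \<le> \<eta>" "\<eta> \<le> 1/4" "8 * \<eta> * m \<le> \<mu>" "24 * norm rs * m * \<eta> \<le> a * \<mu>"
    and near: "norm (offset p + rs) \<le> \<eta> * norm rs" "norm (offset p' + rs) \<le> \<eta> * norm rs"
    and edges: "\<And>i j. (i, j) \<in> E \<Longrightarrow> norm (p $ j - p $ i) \<ge> a \<and> norm (p' $ j - p' $ i) \<ge> a \<and>
      norm (sgn (p $ j - p $ i) + G i j) \<le> \<eta> \<and> norm (sgn (p' $ j - p' $ i) + G i j) \<le> \<eta> \<and>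
      norm (v i j - 2 *\<^sub>R G i j) \<le> \<eta>"
  shows "0 \<le> (\<Sum>(i, j)\<in>E. ((p $ j - p $ i) - (p' $ j - p' $ i)) \<bullet>
    (perp (sgn (p $ j - p $ i)) (v i j) - perp (sgn (p' $ j - p' $ i)) (v i j)))"
proof -
  let ?\<rho> = "norm rs"
  note \<rho> = rs_nonzero
  define d where "d = p - p'"
  define D where "D = norm d"
  define s where "s i j = norm (sgn (p $ j - p $ i) - sgn (p' $ j - p' $ i))" for i j
  \<comment> \<open>The expansion is coercive in the bearing differences Y, but its error term
    involves the distance D: the outcome is m W \<ge> Y (a Y - 6 \<eta> m D). It remains to bound D
    by Y, namely \<mu> D \<le> 4 |rs| Y, by quantitative rigidity and the sphere constraint; the
    smallness conditions on \<eta> are made for these two steps.\<close>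
  define Y where "Y = (\<Sum>(i, j)\<in>E. s i j)"
  define W where "W = (\<Sum>(i, j)\<in>E. ((p $ j - p $ i) - (p' $ j - p' $ i)) \<bullet>
    (perp (sgn (p $ j - p $ i)) (v i j) - perp (sgn (p' $ j - p' $ i)) (v i j)))"
  have m: "m > 0" by (simp add: m_def)
  have D0: "D \<ge> 0" by (simp add: D_def)
  have s0: "s i j \<ge> 0" for i j by (simp add: s_def)
  have Y0: "Y \<ge> 0" unfolding Y_def by (intro sum_nonneg) (auto simp: s0)
  have dd: "(p $ j - p $ i) - (p' $ j - p' $ i) = d $ j - d $ i" for i j
    by (simp add: d_def)
  have dD: "norm (d $ j - d $ i) \<le> 2 * D" for i j
    unfolding D_def by (rule norm_component_diff_le)
  have edge_term: "((p $ j - p $ i) - (p' $ j - p' $ i)) \<bullet>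
      (perp (sgn (p $ j - p $ i)) (v i j) - perp (sgn (p' $ j - p' $ i)) (v i j)) \<ge>
      a * (s i j)\<^sup>2 - 6 * \<eta> * D * s i j" if ij: "(i, j) \<in> E" for i j
  proof -
    have "((p $ j - p $ i) - (p' $ j - p' $ i)) \<bullet>
      (perp (sgn (p $ j - p $ i)) (v i j) - perp (sgn (p' $ j - p' $ i)) (v i j)) \<ge>
      a * (s i j)\<^sup>2 - 3 * \<eta> * norm ((p $ j - p $ i) - (p' $ j - p' $ i)) * s i j"
      unfolding s_def by (rule inner_perp_diff_ge_repelling[OF a _ _ norm_G[OF ij]]) (use edges[OF ij] \<eta> in auto)
    moreover have "3 * \<eta> * norm (d $ j - d $ i) * s i j \<le> 3 * \<eta> * (2 * D) * s i j"
      using dD \<eta> s0 by (intro mult_right_mono mult_left_mono) auto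
    moreover have "3 * \<eta> * (2 * D) * s i j = 6 * \<eta> * D * s i j" by simp
    ultimately show ?thesis unfolding dd by linarith
  qed
  have "(\<Sum>(i, j)\<in>E. a * (s i j)\<^sup>2 - 6 * \<eta> * D * s i j) \<le> W"
    unfolding W_def by (intro sum_mono) (use edge_term in auto)
  then have W: "a * (\<Sum>(i, j)\<in>E. (s i j)\<^sup>2) - 6 * \<eta> * D * Y \<le> W"
    by (simp add: sum_subtractf case_prod_unfold Y_def flip: sum_distrib_left)
  have "Y\<^sup>2 \<le> (\<Sum>(i, j)\<in>E. (s i j)\<^sup>2) * real (card E)"
    unfolding Y_def using sum_squared_le_sum_of_squares[of "\<lambda>(i, j). s i j" E] by (simp add: case_prod_unfold)
  also have "\<dots> \<le> (\<Sum>(i, j)\<in>E. (s i j)\<^sup>2) * m"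
    by (intro mult_left_mono sum_nonneg) (auto simp: m_def)
  finally have "a * Y\<^sup>2 \<le> a * ((\<Sum>(i, j)\<in>E. (s i j)\<^sup>2) * m)"
    using a by (intro mult_left_mono) auto
  moreover have "(a * (\<Sum>(i, j)\<in>E. (s i j)\<^sup>2) - 6 * \<eta> * D * Y) * m \<le> W * m"
    using W m by (intro mult_right_mono) auto
  ultimately have mW: "Y * (a * Y - 6 * \<eta> * m * D) \<le> W * m"
    by (simp add: algebra_simps power2_eq_square)
  \<comment> \<open>The change of an edge splits into a change of direction and a change of length
    along \<open>sgn ?e'\<close>. The latter direction is close to -G, and G may be added to it for
    free because \<open>perp ?G\<close> kills G, so this part is small.\<close>
  have perp_edge: "norm (perp (G i j) (d $ j - d $ i)) \<le> 2 * ?\<rho> * s i j + 2 * D * \<eta>"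
    if ij: "(i, j) \<in> E" for i j
  proof -
    let ?e = "p $ j - p $ i" and ?e' = "p' $ j - p' $ i" and ?G = "G i j"
    have ne: "?e \<noteq> 0" "?e' \<noteq> 0" using edges[OF ij] a by auto
    have "norm ?e *\<^sub>R (sgn ?e - sgn ?e') + (norm ?e - norm ?e') *\<^sub>R sgn ?e'
        = norm ?e *\<^sub>R sgn ?e - norm ?e' *\<^sub>R sgn ?e'"
      by (simp add: scaleR_diff_right scaleR_diff_left)
    also have "\<dots> = ?e - ?e'" using ne by (simp add: sgn_div_norm)
    also have "\<dots> = d $ j - d $ i" by (rule dd)
    finally have "perp ?G (d $ j - d $ i) =
        perp ?G (norm ?e *\<^sub>R (sgn ?e - sgn ?e') + (norm ?e - norm ?e') *\<^sub>R sgn ?e')" by (simp only:)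
    also have "\<dots> = norm ?e *\<^sub>R perp ?G (sgn ?e - sgn ?e') + (norm ?e - norm ?e') *\<^sub>R perp ?G (sgn ?e' + ?G)"
      by (simp only: perp_add perp_scaleR perp_self[OF norm_G[OF ij]] add_0_right)
    finally have pe: "perp ?G (d $ j - d $ i) =
        norm ?e *\<^sub>R perp ?G (sgn ?e - sgn ?e') + (norm ?e - norm ?e') *\<^sub>R perp ?G (sgn ?e' + ?G)" .
    have "norm (perp ?G (d $ j - d $ i)) \<le>
        norm ?e * norm (perp ?G (sgn ?e - sgn ?e')) + \<bar>norm ?e - norm ?e'\<bar> * norm (perp ?G (sgn ?e' + ?G))"
      unfolding pe by (rule order_trans[OF norm_triangle_ineq]) simp
    also have "\<dots> \<le> 2 * ?\<rho> * s i j + 2 * D * \<eta>"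
    proof (intro add_mono mult_mono)
      show "norm ?e \<le> 2 * ?\<rho>" by (rule norm_edge_le[OF n(1)])
      show "norm (perp ?G (sgn ?e - sgn ?e')) \<le> s i j"
        unfolding s_def by (rule norm_perp_le[OF norm_G[OF ij]])
      have "\<bar>norm ?e - norm ?e'\<bar> \<le> norm (?e - ?e')" by (rule norm_triangle_ineq3)
      then show "\<bar>norm ?e - norm ?e'\<bar> \<le> 2 * D" using dD[of j i] unfolding dd by linarith
      show "norm (perp ?G (sgn ?e' + ?G)) \<le> \<eta>"
        using norm_perp_le[OF norm_G[OF ij], of "sgn ?e' + ?G"] edges[OF ij] by linarith
    qed (use \<rho> D0 in auto)
    finally show ?thesis .
  qed
  have "(\<Sum>(i, j)\<in>E. norm (perp (G i j) (d $ j - d $ i))) \<le> (\<Sum>(i, j)\<in>E. 2 * ?\<rho> * s i j + 2 * D * \<eta>)"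
    by (intro sum_mono) (use perp_edge in auto)
  also have "\<dots> = 2 * ?\<rho> * Y + real (card E) * (2 * D * \<eta>)"
    by (simp add: sum.distrib case_prod_unfold Y_def flip: sum_distrib_left)
  also have "\<dots> \<le> 2 * ?\<rho> * Y + m * (2 * D * \<eta>)"
    using D0 \<eta> by (intro add_left_mono mult_right_mono) (auto simp: m_def)
  finally have up: "(\<Sum>(i, j)\<in>E. norm (perp (G i j) (d $ j - d $ i))) \<le> 2 * ?\<rho> * Y + m * (2 * D * \<eta>)" .
  have d_off: "d = offset p - offset p'" by (simp add: d_def offset_def)
  have "\<mu> * norm (d - ((d \<bullet> rs) / ?\<rho>\<^sup>2) *\<^sub>R rs) \<le> (\<Sum>(i, j)\<in>E. norm (perp (G i j) (d $ j - d $ i)))"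
    by (rule kb) (use z in \<open>simp add: d_off sum_subtractf\<close>)
  with up have lo: "\<mu> * norm (d - ((d \<bullet> rs) / ?\<rho>\<^sup>2) *\<^sub>R rs) \<le> 2 * ?\<rho> * Y + m * (2 * D * \<eta>)" by linarith
  \<comment> \<open>Both points lie on the same sphere, so the chord \<open>d\<close> is orthogonal to their sum and nearly
    orthogonal to \<open>rs\<close>.\<close>
  have "offset p \<bullet> offset p = offset p' \<bullet> offset p'" using n by (simp add: dot_square_norm)
  then have "d \<bullet> (offset p + offset p') = 0"
    by (simp add: d_off inner_diff_left inner_add_right inner_commute[of "offset p'" "offset p"])
  then have "2 * (d \<bullet> rs) = d \<bullet> ((offset p + rs) + (offset p' + rs))"
    unfolding inner_add_right by linarith
  also have "\<bar>\<dots>\<bar> \<le> D * norm ((offset p + rs) + (offset p' + rs))"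
    unfolding D_def by (rule Cauchy_Schwarz_ineq2)
  also have "\<dots> \<le> D * (\<eta> * ?\<rho> + \<eta> * ?\<rho>)"
    by (rule mult_left_mono[OF norm_triangle_le D0]) (use near in linarith)
  finally have "\<bar>d \<bullet> rs\<bar> \<le> D * \<eta> * ?\<rho>" by simp
  moreover have "norm (((d \<bullet> rs) / ?\<rho>\<^sup>2) *\<^sub>R rs) = \<bar>d \<bullet> rs\<bar> / ?\<rho>"
    using \<rho> by (simp add: power2_eq_square)
  ultimately have "norm (((d \<bullet> rs) / ?\<rho>\<^sup>2) *\<^sub>R rs) \<le> D * \<eta>"
    using \<rho> by (simp add: divide_le_eq)
  moreover have "D * \<eta> \<le> D * (1/4)" using D0 \<eta> by (intro mult_left_mono) auto
  ultimately have "norm (d - ((d \<bullet> rs) / ?\<rho>\<^sup>2) *\<^sub>R rs) \<ge> 3/4 * D"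
    using norm_triangle_ineq2[of d "((d \<bullet> rs) / ?\<rho>\<^sup>2) *\<^sub>R rs"] unfolding D_def by linarith
  then have "\<mu> * (3/4 * D) \<le> \<mu> * norm (d - ((d \<bullet> rs) / ?\<rho>\<^sup>2) *\<^sub>R rs)"
    using \<mu> by (intro mult_left_mono) auto
  then have "\<mu> * (3/4 * D) \<le> 2 * ?\<rho> * Y + m * (2 * D * \<eta>)" using lo by linarith
  moreover have "8 * \<eta> * m * D \<le> \<mu> * D" using \<eta>(3) D0 by (intro mult_right_mono) auto
  ultimately have "\<mu> * D \<le> 4 * ?\<rho> * Y" by (simp add: algebra_simps)
  then have "a * (\<mu> * D) \<le> a * (4 * ?\<rho> * Y)" using a by (intro mult_left_mono) auto
  moreover have "24 * ?\<rho> * m * \<eta> * D \<le> a * \<mu> * D" using \<eta>(4) D0 by (intro mult_right_mono) auto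
  ultimately have "(4 * ?\<rho>) * (6 * \<eta> * m * D) \<le> (4 * ?\<rho>) * (a * Y)" by (simp add: algebra_simps)
  then have "6 * \<eta> * m * D \<le> a * Y"
    by (rule mult_left_le_imp_le) (use \<rho> in simp)
  then have "0 \<le> Y * (a * Y - 6 * \<eta> * m * D)" using Y0 by simp
  then have "0 \<le> W * m" using mW by linarith
  then show ?thesis using m unfolding W_def by (simp add: zero_le_mult_iff)
qed

lemma edge_limits:
  assumes lim: "((\<lambda>t. offset (p t)) \<longlongrightarrow> - rs) at_top" and ij: "(i, j) \<in> E"
  shows "((\<lambda>t. norm (p t $ j - p t $ i)) \<longlongrightarrow> norm (ps $ j - ps $ i)) at_top"
    "((\<lambda>t. norm (sgn (p t $ j - p t $ i) + G i j)) \<longlongrightarrow> 0) at_top"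
proof -
  let ?l = "norm (ps $ j - ps $ i)"
  have "((\<lambda>t. offset (p t) $ j - offset (p t) $ i) \<longlongrightarrow> (- rs) $ j - (- rs) $ i) at_top"
    by (intro tendsto_intros lim)
  moreover have "(- rs) $ j - (- rs) $ i = - (rs $ j - rs $ i)" by simp
  ultimately have e: "((\<lambda>t. p t $ j - p t $ i) \<longlongrightarrow> - (ps $ j - ps $ i)) at_top"
    by (simp only: offset_diff rs_diff)
  from tendsto_norm[OF e]
  show "((\<lambda>t. norm (p t $ j - p t $ i)) \<longlongrightarrow> ?l) at_top" by (simp only: norm_minus_cancel)
  have ne: "- (ps $ j - ps $ i) \<noteq> 0" using ps_edge(2)[OF ij] by simp
  have "sgn (ps $ j - ps $ i) = G i j"
    using ps_edge(2)[OF ij] norm_G[OF ij] by (subst ps_edge(1)[OF ij]) (simp add: sgn_scaleR sgn_div_norm)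
  then have "((\<lambda>t. sgn (p t $ j - p t $ i)) \<longlongrightarrow> - G i j) at_top"
    using tendsto_sgn[OF e ne] by (simp only: sgn_minus)
  from tendsto_add[OF this tendsto_const[of "G i j"]]
  have "((\<lambda>t. sgn (p t $ j - p t $ i) + G i j) \<longlongrightarrow> 0) at_top" by (simp only: ab_left_minus)
  then show "((\<lambda>t. norm (sgn (p t $ j - p t $ i) + G i j)) \<longlongrightarrow> 0) at_top"
    by (rule tendsto_norm_zero)
qed

text \<open>The derivative of the squared distance of two solutions, see \<open>dist_deriv\<close>:
  the factor 2 from the square cancels the 1/2 of \<open>inner_position_field\<close>.\<close>

definition spread :: "(real \<Rightarrow> real^3^'n) \<Rightarrow> (real \<Rightarrow> real^3^'n) \<Rightarrow> real \<Rightarrow> real" where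
  "spread p p' t = (\<Sum>(i, j)\<in>E. ((p t $ j - p t $ i) - (p' t $ j - p' t $ i)) \<bullet>
    (perp (sgn (p t $ j - p t $ i)) (b t i j) - perp (sgn (p' t $ j - p' t $ i)) (b t i j)))"

lemma dist_deriv:
  assumes p: "trajectory p" and p': "trajectory p'" and t: "t \<ge> 0"
  shows "((\<lambda>t. (norm (offset (p t) - offset (p' t)))\<^sup>2) has_real_derivative spread p p' t) (at t within {0..})"
proof -
  let ?d = "\<lambda>t. offset (p t) - offset (p' t)"
  let ?f = "position_field E g (Q t) (p t)" and ?f' = "position_field E g (Q t) (p' t)"
  have d: "(?d has_vector_derivative ?f - ?f') (at t within {0..})"
    by (rule has_vector_derivative_diff[OF offset_deriv[OF p t] offset_deriv[OF p' t]])
  have "((\<lambda>t. ?d t \<bullet> ?d t) has_vector_derivative ?d t \<bullet> (?f - ?f') + (?f - ?f') \<bullet> ?d t) (at t within {0..})"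
    by (rule bounded_bilinear.has_vector_derivative[OF bounded_bilinear_inner d d])
  moreover have "x \<bullet> (y - y') + (y - y') \<bullet> x = 2 * (x \<bullet> y) - 2 * (x \<bullet> y')" for x y y' :: "real^3^'n"
    by (simp add: inner_diff_left inner_diff_right inner_commute)
  then have "?d t \<bullet> (?f - ?f') + (?f - ?f') \<bullet> ?d t = 2 * (?d t \<bullet> ?f) - 2 * (?d t \<bullet> ?f')" .
  moreover have "\<dots> = spread p p' t"
  proof -
    have "?d t $ j - ?d t $ i = (p t $ j - p t $ i) - (p' t $ j - p' t $ i)" for i j
      by (simp add: offset_def stack_const_def)
    then show ?thesis
      unfolding inner_field[OF p t] inner_field[OF p' t] spread_def
      by (simp add: case_prod_unfold inner_diff_right[of _ "perp _ _"] sum_subtractf)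
  qed
  ultimately show ?thesis
    by (simp add: has_real_derivative_iff_has_vector_derivative power2_norm_eq_inner)
qed

lemma spread_eventually_nonneg:
  assumes p: "trajectory p" and p': "trajectory p'"
    and lim: "((\<lambda>t. offset (p t)) \<longlongrightarrow> - rs) at_top" and lim': "((\<lambda>t. offset (p' t)) \<longlongrightarrow> - rs) at_top"
  shows "\<forall>\<^sub>F t in at_top. 0 \<le> spread p p' t"
proof -
  let ?\<rho> = "norm rs"
  note \<rho> = rs_nonzero
  define m where "m = real (card E) + 1"
  have m: "m > 0" by (simp add: m_def)
  obtain a0 where a0: "a0 > 0" "\<And>i j. (i, j) \<in> E \<Longrightarrow> a0 \<le> norm (ps $ j - ps $ i)"
    using edge_length_bound by blast
  obtain \<mu> where \<mu>: "\<mu> > 0" "\<And>v. (\<Sum>i\<in>UNIV. v $ i) = 0 \<Longrightarrow>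
    \<mu> * norm (v - ((v \<bullet> rs) / ?\<rho>\<^sup>2) *\<^sub>R rs) \<le> (\<Sum>(i, j)\<in>E. norm (perp (G i j) (v $ j - v $ i)))"
    using kernel_bound by blast
  define a where "a = a0 / 2"
  have a: "a > 0" "a < a0" using a0 by (auto simp: a_def)
  \<comment> \<open>The minimum of the three smallness bounds required by
    \<open>repelling_sum_nonneg\<close>. There a is half the least target edge length, so all edges
    eventually exceed it near the opposite configuration.\<close>
  define \<eta> where "\<eta> = min (1/4) (min (\<mu> / (8 * m)) (a * \<mu> / (24 * ?\<rho> * m)))"
  have \<eta>: "\<eta> > 0" "\<eta> \<le> 1/4" "\<eta> \<le> \<mu> / (8 * m)" "\<eta> \<le> a * \<mu> / (24 * ?\<rho> * m)"
    using \<mu> m a \<rho> by (auto simp: \<eta>_def)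
  have \<eta>': "8 * \<eta> * m \<le> \<mu>" "24 * ?\<rho> * m * \<eta> \<le> a * \<mu>"
    using \<eta>(3,4) m \<rho> by (simp_all add: le_divide_eq mult_ac)
  have near: "\<forall>\<^sub>F t in at_top. norm (offset (x t) + rs) \<le> \<eta> * ?\<rho>"
    if "((\<lambda>t. offset (x t)) \<longlongrightarrow> - rs) at_top" for x
  proof -
    have "((\<lambda>t. offset (x t) + rs) \<longlongrightarrow> 0) at_top"
      using tendsto_add[OF that tendsto_const[of rs]] by simp
    then have "((\<lambda>t. norm (offset (x t) + rs)) \<longlongrightarrow> 0) at_top" by (rule tendsto_norm_zero)
    then have "\<forall>\<^sub>F t in at_top. norm (offset (x t) + rs) < \<eta> * ?\<rho>"
      by (rule order_tendstoD(2)) (use \<eta> \<rho> in simp)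
    then show ?thesis by (rule eventually_mono) simp
  qed
  have long: "\<forall>\<^sub>F t in at_top. a < norm (x t $ j - x t $ i) \<and> norm (sgn (x t $ j - x t $ i) + G i j) < \<eta>"
    if "((\<lambda>t. offset (x t)) \<longlongrightarrow> - rs) at_top" "(i, j) \<in> E" for x i j
    by (intro eventually_conj order_tendstoD(1)[OF edge_limits(1)[OF that]] order_tendstoD(2)[OF edge_limits(2)[OF that]])
      (use a a0(2)[OF that(2)] \<eta> in auto)
  have "\<forall>\<^sub>F t in at_top. \<forall>e\<in>E.
     (a < norm (p t $ snd e - p t $ fst e) \<and> norm (sgn (p t $ snd e - p t $ fst e) + G (fst e) (snd e)) < \<eta>) \<and>
     (a < norm (p' t $ snd e - p' t $ fst e) \<and> norm (sgn (p' t $ snd e - p' t $ fst e) + G (fst e) (snd e)) < \<eta>) \<and>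
     norm (b t (fst e) (snd e) - 2 *\<^sub>R G (fst e) (snd e)) < \<eta>"
    by (intro eventually_ball_finite ballI eventually_conj[OF long[OF lim] eventually_conj[OF long[OF lim'] order_tendstoD(2)[OF b_lim]]])
      (use \<eta> in auto)
  with near[OF lim] near[OF lim'] eventually_ge_at_top[of 0]
  show ?thesis
  proof eventually_elim
    case (elim t)
    show ?case
      unfolding spread_def
    proof (rule repelling_sum_nonneg[OF \<mu>(2,1) a(1)])
      show "norm (offset (p t)) = ?\<rho>" "norm (offset (p' t)) = ?\<rho>"
        using norm_offset[OF p] norm_offset[OF p'] elim by auto
      show "(\<Sum>i\<in>UNIV. offset (p t) $ i) = 0" "(\<Sum>i\<in>UNIV. offset (p' t) $ i) = 0"
        using sum_offset[OF p] sum_offset[OF p'] elim by auto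
      show "0 \<le> \<eta>" "\<eta> \<le> 1/4" using \<eta> by auto
      show "8 * \<eta> * (real (card E) + 1) \<le> \<mu>" "24 * ?\<rho> * (real (card E) + 1) * \<eta> \<le> a * \<mu>"
        using \<eta>' by (simp_all add: m_def)
      show "norm (offset (p t) + rs) \<le> \<eta> * ?\<rho>" "norm (offset (p' t) + rs) \<le> \<eta> * ?\<rho>"
        using elim by auto
      show "norm (p t $ j - p t $ i) \<ge> a \<and> norm (p' t $ j - p' t $ i) \<ge> a \<and>
        norm (sgn (p t $ j - p t $ i) + G i j) \<le> \<eta> \<and> norm (sgn (p' t $ j - p' t $ i) + G i j) \<le> \<eta> \<and>
        norm (b t i j - 2 *\<^sub>R G i j) \<le> \<eta>" if "(i, j) \<in> E" for i j
        using bspec[OF elim(4) that] by simp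
    qed
  qed
qed

text \<open>A continuous positive edge length attains its minimum on a compact interval. The bound
  may deteriorate as T grows, which is why it is only used up to a fixed time.\<close>

lemma edges_bounded_below:
  assumes p: "trajectory p"
  shows "\<exists>\<delta>>0. \<forall>(i, j)\<in>E. \<forall>t\<in>{0..T}. \<delta> \<le> norm (p t $ j - p t $ i)"
proof -
  have "\<exists>\<delta>>0. \<forall>e\<in>E. \<forall>t\<in>{0..T}. \<delta> \<le> norm (p t $ snd e - p t $ fst e)"
  proof (rule finite_uniform_lower_bound)
    fix e assume e: "e \<in> E"
    let ?f = "\<lambda>t. norm (offset (p t) $ snd e - offset (p t) $ fst e)"
    have "continuous (at t within {0..T}) (\<lambda>t. offset (p t))" if "t \<in> {0..T}" for t
      by (rule continuous_within_subset[OF has_vector_derivative_continuous[OF offset_deriv[OF p]]])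
        (use that in auto)
    then have "continuous_on {0..T} (\<lambda>t. offset (p t))"
      by (simp add: continuous_on_eq_continuous_within)
    then have cont: "continuous_on {0..T} ?f" by (intro continuous_intros)
    show "\<exists>\<delta>>0. \<forall>t\<in>{0..T}. \<delta> \<le> norm (p t $ snd e - p t $ fst e)"
    proof (cases "{0..T} = {}")
      case False
      then obtain t0 where t0: "t0 \<in> {0..T}" "\<And>t. t \<in> {0..T} \<Longrightarrow> ?f t0 \<le> ?f t"
        using continuous_attains_inf[OF compact_Icc False cont] by blast
      have "p t0 $ snd e - p t0 $ fst e \<noteq> 0"
        by (rule trajectory_edge_nonzero[OF p]) (use t0 e in auto)
      then have "?f t0 > 0" by (simp add: offset_diff)
      then show ?thesis using t0(2) unfolding offset_diff by blast
    qed (auto intro: zero_less_one)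
  qed simp
  then show ?thesis by (simp add: case_prod_unfold)
qed

text \<open>A one-sided Lipschitz estimate: it limits how fast the distance of two solutions can
  shrink, as needed for Gronwall backwards in time. An edge of the difference is at most twice the
  difference, whence the factor 4.\<close>

lemma spread_ge:
  assumes p: "trajectory p" and p': "trajectory p'"
  shows "\<exists>K. \<forall>t\<in>{0..T}. spread p p' t \<ge> - K * (norm (offset (p t) - offset (p' t)))\<^sup>2"
proof -
  obtain \<delta>1 \<delta>2 where \<delta>1: "\<delta>1 > 0" "\<And>i j t. (i, j) \<in> E \<Longrightarrow> t \<in> {0..T} \<Longrightarrow> \<delta>1 \<le> norm (p t $ j - p t $ i)"
    and \<delta>2: "\<delta>2 > 0" "\<And>i j t. (i, j) \<in> E \<Longrightarrow> t \<in> {0..T} \<Longrightarrow> \<delta>2 \<le> norm (p' t $ j - p' t $ i)"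
    using edges_bounded_below[OF p, of T] edges_bounded_below[OF p', of T] by blast
  define \<delta> where "\<delta> = min \<delta>1 \<delta>2"
  have \<delta>: "\<delta> > 0" "\<And>i j t. (i, j) \<in> E \<Longrightarrow> t \<in> {0..T} \<Longrightarrow> \<delta> \<le> norm (p t $ j - p t $ i)"
    "\<And>i j t. (i, j) \<in> E \<Longrightarrow> t \<in> {0..T} \<Longrightarrow> \<delta> \<le> norm (p' t $ j - p' t $ i)"
    using \<delta>1 \<delta>2 by (auto simp: \<delta>_def intro: min.coboundedI1 min.coboundedI2)
  define C where "C = 4 * (2 * norm rs) * 2 / \<delta>\<^sup>2 + 2 * 2 / \<delta>"
  have C: "C \<ge> 0" using \<delta> by (simp add: C_def)
  have "spread p p' t \<ge> - (real (card E) * (4 * C)) * (norm (offset (p t) - offset (p' t)))\<^sup>2"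
    if t: "t \<in> {0..T}" for t
  proof -
    let ?d = "offset (p t) - offset (p' t)"
    have t0: "t \<ge> 0" using t by simp
    have "((p t $ j - p t $ i) - (p' t $ j - p' t $ i)) \<bullet>
      (perp (sgn (p t $ j - p t $ i)) (b t i j) - perp (sgn (p' t $ j - p' t $ i)) (b t i j)) \<ge> - (4 * C * (norm ?d)\<^sup>2)"
      if ij: "(i, j) \<in> E" for i j
    proof -
      let ?e = "p t $ j - p t $ i" and ?e' = "p' t $ j - p' t $ i"
      have 1: "(?e - ?e') \<bullet> (perp (sgn ?e) (b t i j) - perp (sgn ?e') (b t i j)) \<ge> - C * (norm (?e - ?e'))\<^sup>2"
        unfolding C_def
        by (rule inner_perp_diff_ge_lipschitz[OF \<delta>(1) \<delta>(2)[OF ij t] \<delta>(3)[OF ij t]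
              norm_edge_le[OF norm_offset[OF p t0]] norm_edge_le[OF norm_offset[OF p' t0]] norm_b_le[OF t0 ij]])
      have "?e - ?e' = ?d $ j - ?d $ i" by (simp add: offset_def stack_const_def)
      then have "norm (?e - ?e') \<le> 2 * norm ?d" by (simp only: norm_component_diff_le)
      then have "(norm (?e - ?e'))\<^sup>2 \<le> (2 * norm ?d)\<^sup>2" by (intro power_mono) auto
      then have "C * (norm (?e - ?e'))\<^sup>2 \<le> C * (2 * norm ?d)\<^sup>2" using C by (rule mult_left_mono)
      then show ?thesis using 1 by (simp add: power_mult_distrib)
    qed
    then have "(\<Sum>(i, j)\<in>E. - (4 * C * (norm ?d)\<^sup>2)) \<le> spread p p' t"
      unfolding spread_def by (intro sum_mono) auto
    then show ?thesis by (simp add: case_prod_unfold)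
  qed
  then show ?thesis by blast
qed

text \<open>From some time T on, the squared distance u is nondecreasing with limit 0, so u T = 0.
  Since \<open>exp (K * t) * u t\<close> is nondecreasing on \<open>{0..T}\<close>, also u 0 =
  0.\<close>

lemma repelled_unique:
  assumes p: "trajectory p" and p': "trajectory p'"
    and lim: "((\<lambda>t. offset (p t)) \<longlongrightarrow> - rs) at_top" and lim': "((\<lambda>t. offset (p' t)) \<longlongrightarrow> - rs) at_top"
  shows "p 0 = p' 0"
proof -
  define u where "u t = (norm (offset (p t) - offset (p' t)))\<^sup>2" for t
  have deriv: "(u has_real_derivative spread p p' t) (at t within {0..})" if "t \<ge> 0" for t
    using dist_deriv[OF p p' that] by (simp only: u_def[abs_def])
  obtain T0 where T0: "\<And>t. t \<ge> T0 \<Longrightarrow> 0 \<le> spread p p' t"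
    using spread_eventually_nonneg[OF p p' lim lim'] by (auto simp: eventually_at_top_linorder)
  define T where "T = max T0 0"
  have T: "T \<ge> 0" "\<And>t. t \<ge> T \<Longrightarrow> 0 \<le> spread p p' t" using T0 by (auto simp: T_def)
  have mono: "u T \<le> u t" if "t \<ge> T" for t
    by (rule nondecreasing_if_deriv_nonneg_within[OF T(1) that deriv]) (use T in auto)
  have "(u \<longlongrightarrow> (norm (- rs - - rs))\<^sup>2) at_top"
    unfolding u_def by (intro tendsto_intros lim lim')
  then have "(u \<longlongrightarrow> 0) at_top" by simp
  then have uT: "u T \<le> 0"
    by (rule tendsto_lowerbound) (auto intro: eventually_at_top_linorderI mono)
  obtain K where K: "\<And>t. t \<in> {0..T} \<Longrightarrow> spread p p' t \<ge> - K * u t"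
    using spread_ge[OF p p', of T] unfolding u_def by blast
  have "exp (K * 0) * u 0 \<le> exp (K * T) * u T"
  proof (rule nondecreasing_if_deriv_nonneg_within[where f = "\<lambda>t. exp (K * t) * u t"
        and f' = "\<lambda>t. exp (K * t) * (K * u t + spread p p' t)"])
    show "((\<lambda>t. exp (K * t) * u t) has_real_derivative exp (K * t) * (K * u t + spread p p' t)) (at t within {0..})"
      if "0 \<le> t" for t
    proof -
      have "((\<lambda>t. exp (K * t)) has_real_derivative exp (K * t) * K) (at t within {0..})"
        by (auto intro!: derivative_eq_intros)
      from DERIV_mult[OF this deriv[OF that]] show ?thesis by (simp add: algebra_simps)
    qed
    show "0 \<le> exp (K * t) * (K * u t + spread p p' t)" if "0 < t" "t < T" for t
      using K[of t] that by simp
  qed (use T in auto)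
  also have "\<dots> \<le> 0" using uT by (intro mult_nonneg_nonpos) auto
  finally have "u 0 \<le> 0" by simp
  then have "offset (p 0) - offset (p' 0) = 0" by (simp add: u_def)
  then show ?thesis by (simp add: offset_def)
qed

end

theorem theorem15:
  fixes E :: "('n::finite \<times> 'n) set"
    and g :: "'n \<Rightarrow> 'n \<Rightarrow> real^3"
    and Q :: "real \<Rightarrow> real^3^3^'n"
    and c :: "real^3" and s :: real
    and pstar rstar :: "real^3^'n"
  assumes "CARD('n) \<ge> 2"
    and "sym E" and "irrefl E"
    and "bearing_constraints E g"
    and "feasible E g"
    and "ensures_inf_bearing_rigidity E g"
    and "orientation_solution E Q"
    and "\<exists>R. rotation_matrix R \<and> (\<forall>i. positive_definite (transpose R ** Q 0 $ i))"
    and "s > 0"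
    and "pstar = target_configuration E g (limit_orientation Q) c s"
    and "rstar = pstar - stack_const c"
  shows "\<exists>N \<subseteq> error_sphere rstar. surface_null N \<and>
    (\<forall>\<delta>0 \<in> error_sphere rstar - N. \<forall>p.
       position_solution E g Q p \<and> p 0 = pstar + \<delta>0 \<longrightarrow>
       ((\<lambda>t. p t - pstar) \<longlongrightarrow> 0) at_top)"
proof -
  interpret flow: orientation_flow E Q
    by unfold_locales fact+
  obtain q where q: "satisfies_bearings E g q" using \<open>feasible E g\<close> by (auto simp: feasible_def)
  then have rigid: "inf_bearing_rigid E q" "collision_free E q"
    using \<open>ensures_inf_bearing_rigidity E g\<close>
    by (auto simp: ensures_inf_bearing_rigidity_def satisfies_bearings_def)
  obtain R where R: "rotation_matrix R" "\<And>i. positive_definite (transpose R ** Q 0 $ i)"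
    using assms by blast
  have al: "flow.align R 0 i > 0" "2 * (flow.align R 0 i)\<^sup>2 > 1" for i
    unfolding flow.align_def
    by (rule positive_definite_half_cos[OF rotation_matrix_transpose_mult[OF R(1) flow.rotation[OF order_refl]] R(2)])+
  \<comment> \<open>A common level for all agents: the minimum is attained, so it inherits the
    strict bounds that positive definiteness gives for each agent.\<close>
  define m where "m = Min (range (flow.align R 0))"
  have m: "\<And>i. m \<le> flow.align R 0 i" "m \<in> range (flow.align R 0)"
    unfolding m_def by (auto intro: Min_le Min_in)
  then have m': "m > 0" "2 * m\<^sup>2 > 1" using al by auto
  have "\<exists>L. rotation_matrix L \<and> (\<forall>i. ((\<lambda>t. Q t $ i) \<longlongrightarrow> L) at_top)"
    by (rule flow.orientations_converge[OF _ R(1) m' m(1)]) (rule inf_bearing_rigid_connected[OF rigid])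
  then obtain L where L: "rotation_matrix L" "\<And>i. ((\<lambda>t. Q t $ i) \<longlongrightarrow> L) at_top" by blast
  have Lim: "limit_orientation Q = L"
    unfolding limit_orientation_def
  proof (rule the_equality)
    show "\<forall>i. ((\<lambda>t. Q t $ i) \<longlongrightarrow> L) at_top" using L by blast
    show "L' = L" if "\<forall>i. ((\<lambda>t. Q t $ i) \<longlongrightarrow> L') at_top" for L'
      using that L tendsto_unique[OF trivial_limit_at_top_linorder] by blast
  qed
  have Lo: "orthogonal_matrix L" using L by (simp add: rotation_matrix_def)
  \<comment> \<open>The facts are stated for L, while \<open>pstar\<close> is defined through
    \<open>limit_orientation Q\<close>. They are folded into that form to recognise
    \<open>pstar\<close>, then unfolded again.\<close>
  note target = target_configuration_props[OF \<open>CARD('n) \<ge> 2\<close> Lo \<open>feasible E g\<close>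
      \<open>ensures_inf_bearing_rigidity E g\<close> \<open>s > 0\<close>, of c, folded Lim, folded \<open>pstar = _\<close>, unfolded Lim]
  interpret bearing_flow E g Q L pstar
  proof unfold_locales
    show "sym E" "bearing_constraints E g" by fact+
    show "orthogonal_matrix (Q t $ i)" if "t \<ge> 0" for t i
      using flow.rotation[OF that] by (simp add: rotation_matrix_def)
    show "((\<lambda>t. Q t $ i) \<longlongrightarrow> L) at_top" for i by (rule L(2))
    show "orthogonal_matrix L" by (rule Lo)
    show "satisfies_bearings E (\<lambda>i j. L *v g i j) pstar" by (rule target(3))
    show "\<exists>x \<alpha>. dq = stack_const x + \<alpha> *\<^sub>R pstar"
      if "\<And>i j. (i, j) \<in> E \<Longrightarrow> \<exists>l. dq $ j - dq $ i = l *\<^sub>R (pstar $ j - pstar $ i)" for dq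
      using rotated_bearings_kernel[OF Lo \<open>ensures_inf_bearing_rigidity E g\<close> target(3) that] .
    show "config_scale pstar > 0" using target(2) \<open>s > 0\<close> by simp
  qed
  have rs: "rs = rstar" by (simp add: rs_def target(1) \<open>rstar = _\<close>)
  have off: "offset (pstar + \<delta>) = \<delta> + rs" "offset p - rs = p - pstar" for \<delta> p
    by (simp_all add: offset_def rs_def)
  \<comment> \<open>One failing solution suffices to put an initial value into N. By
    \<open>repelled\<close> that solution tends to the opposite configuration, and
    \<open>repelled_unique\<close> compares any two of this kind.\<close>
  define N where "N = {\<delta>0 \<in> error_sphere rstar. \<exists>p. position_solution E g Q p \<and> p 0 = pstar + \<delta>0 \<and>
      \<not> ((\<lambda>t. p t - pstar) \<longlongrightarrow> 0) at_top}"
  have repelled: "trajectory p \<and> ((\<lambda>t. offset (p t)) \<longlongrightarrow> - rs) at_top"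
    if "\<delta>0 \<in> error_sphere rstar" "position_solution E g Q p" "p 0 = pstar + \<delta>0"
      "\<not> ((\<lambda>t. p t - pstar) \<longlongrightarrow> 0) at_top" for \<delta>0 p
  proof -
    have p: "trajectory p"
      using that sum_rs by (simp add: trajectory_def off error_sphere_def rs sum.distrib)
    moreover have "\<not> ((\<lambda>t. offset (p t)) \<longlongrightarrow> rs) at_top"
      using that(4) LIM_zero[of "\<lambda>t. offset (p t)" rs at_top] unfolding off by blast
    ultimately show ?thesis using limit_dichotomy by blast
  qed
  have N: "\<exists>p. trajectory p \<and> ((\<lambda>t. offset (p t)) \<longlongrightarrow> - rs) at_top \<and> p 0 = pstar + \<delta>"
    if "\<delta> \<in> N" for \<delta>
    using that repelled unfolding N_def mem_Collect_eq by metis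
  have "\<delta> = \<delta>'" if \<delta>: "\<delta> \<in> N" "\<delta>' \<in> N" for \<delta> \<delta>'
  proof -
    obtain p p' where p: "trajectory p" "((\<lambda>t. offset (p t)) \<longlongrightarrow> - rs) at_top" "p 0 = pstar + \<delta>"
      and p': "trajectory p'" "((\<lambda>t. offset (p' t)) \<longlongrightarrow> - rs) at_top" "p' 0 = pstar + \<delta>'"
      using N[OF \<delta>(1)] N[OF \<delta>(2)] by blast
    show ?thesis using repelled_unique[OF p(1) p'(1) p(2) p'(2)] p(3) p'(3) by simp
  qed
  then obtain x where "N \<subseteq> {x}" by blast
  \<comment> \<open>The dimension \<open>3 * CARD('n) - 4\<close> is at least 2, so a set with at
    most one point is null.\<close>
  then have "surface_null N"
    unfolding surface_null_def using \<open>CARD('n) \<ge> 2\<close> by (intro hausdorff_measure_singleton) auto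
  then show ?thesis
    by (intro exI[of _ N]) (auto simp: N_def)
qed

end
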